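(* Let $D=(V,E)$ be a spacetime graph with edge weights in a commutative ring $R$, and let $(\mathcal X,\mathcal Y)$ be a planar pair of source and target sets. Fix an initial state $x_1\preceq\cdots\preceq x_n$ in $\mathcal X$ and a final state (ghost set $\mathcal G$, heir set $\mathcal H$, role set $\mathcal R=\mathcal H\cup\mathcal G$, positions $y_f\in\mathcal Y$ for $f\in\mathcal R$, with $y_H\preceq y_{H'}$ whenever $H\triangleleft H'$ are heirs), with ghost sign $\varepsilon:\mathcal G\to\{+1,-1\}$. Let $M$ be the $n\times n$ matrix with rows indexed by the actors $I\in\mathcal A$ in label order, columns indexed by the roles $f\in\mathcal R$ in $\min$-order, and entries $$M_{I,f}=\begin{cases} W(x_I\to y_H) & f=H \text{ is an heir},\\ -[\varepsilon_g=-1]\,W(x_I\to y_g) & f=g\text{ is a ghost and } I\triangleleft g,\\ [\varepsilon_g=+1]\,W(x_I\to y_g) & f=g\text{ is a ghost and } g\triangleleft I,\end{cases}$$ where $[\cdot]$ is the Iverson bracket. Let $Z=\sum_{\mathcal P}w(\mathcal P)$ be the total weight of all performances $\mathcal P$ with this initial and final state. Then $$Z=\det M.$$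
   Context: Spacetime graph: a directed acyclic graph $D=(V,E)$ with edge weights $w:E\to R$, $R$ a commutative ring. Write $u\lessdot v$ if there is a directed path from $u$ to $v$; fix a linear extension $\le$ of this partial order. A path from $x$ to $y$ is a vertex sequence $(v_0,\dots,v_\ell)$, $\ell\ge 0$, $v_0=x$, $v_\ell=y$, $(v_i,v_{i+1})\in E$; it is identified with its vertex set, and $w(P)=\prod_i w(v_i\to v_{i+1})$. $W(x\to y)=\sum_P w(P)$ over all paths $P$ from $x$ to $y$ (there are finitely many paths between any two vertices, so the sums make sense). Planarity: $\mathcal X,\mathcal Y\subseteq V$ each carry a linear order $\prec$ (weak version $\preceq$). $(\mathcal X,\mathcal Y)$ is planar if (P1) for $x\preceq x'$ in $\mathcal X$ and $y'\preceq y$ in $\mathcal Y$, every path from $x$ to $y$ intersects every path from $x'$ to $y'$; (P2) if $A,B,C$ are paths starting at $x\preceq x'\preceq x''$ in $\mathcal X$ respectively and ending in $\mathcal Y$, and $v\in A\cap C$, then there is a vertex $w\le v$ with $w\in B\cap(A\cup C)$. Labels: actors (initial particles) $\mathcal A=\{I_1,\dots,I_n\}$, $I_j=[j,j+1)$, start at $x_{I_j}=x_j$. Junctions $\mathcal J=\{2,\dots,n\}$. Label order $\triangleleft$ on half-open integer intervals and junctions: $[a,b)\triangleleft g$ iff $b\le g$; $g\triangleleft[a,b)$ iff $g\le a$; $[a,b)\triangleleft[a',b')$ iff $b\le a'$; $g\triangleleft g'$ iff $g<g'$. Final state: a ghost set $\mathcal G\subseteq\mathcal J$; the heir set $\mathcal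 H$ of maximal half-open integer intervals $[a,b)\subseteq[1,n+1)$ containing no junction of $\mathcal J\setminus\mathcal G$ in their interior; $\mathcal R=\mathcal H\cup\mathcal G$, $|\mathcal R|=n$; positions $y_f\in\mathcal Y$ with $y_H\preceq y_{H'}$ if $H\triangleleft H'$. For $g\in\mathcal G$, $\mathrm{heir}(g)$ is the unique heir $[a,b)$ with $a<g<b$. The $\min$-order on $\mathcal R$ orders roles by $\min[a,b)=a$, $\min g=g$; $\min$ is a bijection $\mathcal R\to\{1,\dots,n\}$. Ghost sign: $\varepsilon_g=+1$ if $y_g\preceq y_{\mathrm{heir}(g)}$ and $\varepsilon_g=-1$ if $y_{\mathrm{heir}(g)}\preceq y_g$; if $y_g=y_{\mathrm{heir}(g)}$ either sign may be chosen. Performances: a genealogy forest is a family of pairwise vertex-disjoint trees $(T_H)_{H\in\mathcal H}$, where $T_H$ is a subgraph of $D$ that is a tree oriented towards its root $y_H$ (every vertex other than $y_H$ has exactly one outgoing edge in $T_H$, $y_H$ has none) and is the union of the directed paths (trajectories) in $T_H$ from $x_I$ to $y_H$ over the actors $I\subseteq H$ (paths may have length zero; $x_I$ may lie on other trajectories). The label $I_v$ of a vertex $v$ is the union of the actors whose trajectories pass through $v$ (it is an interval). For $g\in\mathcal G$, $c_g$ is the earliest vertex of the forest whose label contains $g$ in its interior, i.e. the first common vertex of the trajectories of $I_{g-1}$ and $I_g$. A performance $\mathcal P$ is a genealogy forest together with, for each $g\in\mathcal G$, a ghost path $\Gamma_g$ in $D$ from $c_g$ to $y_g$ (ghost paths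 are otherwise unrestricted). Its weight is $w(\mathcal P)=\prod_{e\text{ tree edge}}w(e)\cdot\prod_{g\in\mathcal G}w(\Gamma_g)$, each tree edge of the forest counted once. *)

theory Defs
  imports "Jordan_Normal_Form.Determinant"
begin

section \<open>Spacetime graphs and paths\<close>

text \<open>A path is a nonempty list of vertices; lists of length one are the paths of length zero.\<close>

definition is_path :: "'v set \<Rightarrow> 'v rel \<Rightarrow> 'v \<Rightarrow> 'v list \<Rightarrow> 'v \<Rightarrow> bool" where
  "is_path V E x p y \<longleftrightarrow>
     p \<noteq> [] \<and> hd p = x \<and> last p = y \<and> set p \<subseteq> V \<and> successively (\<lambda>u v. (u, v) \<in> E) p"

definition path_edges :: "'v list \<Rightarrow> ('v \<times> 'v) list" where
  "path_edges p = zip p (tl p)"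

definition path_weight :: "('v \<times> 'v \<Rightarrow> 'a::comm_ring_1) \<Rightarrow> 'v list \<Rightarrow> 'a" where
  "path_weight w p = (\<Prod>e\<leftarrow>path_edges p. w e)"

definition path_sum :: "'v set \<Rightarrow> 'v rel \<Rightarrow> ('v \<times> 'v \<Rightarrow> 'a::comm_ring_1) \<Rightarrow> 'v \<Rightarrow> 'v \<Rightarrow> 'a" where
  "path_sum V E w x y = (\<Sum>p | is_path V E x p y. path_weight w p)"

text \<open>The vertex set may be infinite, as long as there are only finitely many paths between any
  two vertices. The relation \<open>leV\<close> is the fixed (reflexive) linear extension of reachability.\<close>

definition spacetime_graph :: "'v set \<Rightarrow> 'v rel \<Rightarrow> 'v rel \<Rightarrow> bool" where
  "spacetime_graph V E leV \<longleftrightarrow>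
     E \<subseteq> V \<times> V \<and> acyclic E \<and>
     linear_order_on V leV \<and> E\<^sup>+ \<subseteq> leV \<and>
     (\<forall>u\<in>V. \<forall>v\<in>V. finite {p. is_path V E u p v})"


section \<open>Planarity\<close>

text \<open>The relations \<open>rX\<close> and \<open>rY\<close> are the weak versions of the linear orders on the sources \<open>X\<close> and
  the targets \<open>Y\<close>.\<close>

definition planar_pair ::
  "'v set \<Rightarrow> 'v rel \<Rightarrow> 'v rel \<Rightarrow> 'v set \<Rightarrow> 'v rel \<Rightarrow> 'v set \<Rightarrow> 'v rel \<Rightarrow> bool" where
  "planar_pair V E leV X rX Y rY \<longleftrightarrow>
     X \<subseteq> V \<and> linear_order_on X rX \<and> Y \<subseteq> V \<and> linear_order_on Y rY \<and>
     (\<forall>x\<in>X. \<forall>x'\<in>X. \<forall>y\<in>Y. \<forall>y'\<in>Y. \<forall>A B.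
        (x, x') \<in> rX \<longrightarrow> (y', y) \<in> rY \<longrightarrow> is_path V E x A y \<longrightarrow> is_path V E x' B y' \<longrightarrow>
        set A \<inter> set B \<noteq> {}) \<and>
     (\<forall>x\<in>X. \<forall>x'\<in>X. \<forall>x''\<in>X. \<forall>y\<in>Y. \<forall>y'\<in>Y. \<forall>y''\<in>Y. \<forall>A B C v.
        (x, x') \<in> rX \<longrightarrow> (x', x'') \<in> rX \<longrightarrow>
        is_path V E x A y \<longrightarrow> is_path V E x' B y' \<longrightarrow> is_path V E x'' C y'' \<longrightarrow>
        v \<in> set A \<inter> set C \<longrightarrow>
        (\<exists>u. (u, v) \<in> leV \<and> u \<in> set B \<inter> (set A \<union> set C)))"


section \<open>Labels, initial and final states\<close>

text \<open>\<open>Ival a b\<close> stands for the half-open integer interval $[a,b)$.\<close>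

datatype label = Ival nat nat | Junction nat

fun label_less :: "label \<Rightarrow> label \<Rightarrow> bool" (infix "\<triangleleft>" 50) where
  "Ival a b \<triangleleft> Junction g \<longleftrightarrow> b \<le> g"
| "Junction g \<triangleleft> Ival a b \<longleftrightarrow> g \<le> a"
| "Ival a b \<triangleleft> Ival a' b' \<longleftrightarrow> b \<le> a'"
| "Junction g \<triangleleft> Junction g' \<longleftrightarrow> g < g'"

fun label_min :: "label \<Rightarrow> nat" where
  "label_min (Ival a b) = a"
| "label_min (Junction g) = g"

fun in_interior :: "nat \<Rightarrow> label \<Rightarrow> bool" where
  "in_interior g (Ival a b) \<longleftrightarrow> a < g \<and> g < b"
| "in_interior g (Junction h) \<longleftrightarrow> False"

text \<open>Containment of half-open intervals; only applied to nonempty ones.\<close>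

fun subinterval :: "label \<Rightarrow> label \<Rightarrow> bool" where
  "subinterval (Ival a b) (Ival a' b') \<longleftrightarrow> a' \<le> a \<and> b \<le> b'"
| "subinterval _ _ \<longleftrightarrow> False"

definition actor :: "nat \<Rightarrow> label" where
  "actor j = Ival j (j + 1)"

definition junctions :: "nat \<Rightarrow> nat set" where
  "junctions n = {2..n}"

definition uncut_intervals :: "nat \<Rightarrow> nat set \<Rightarrow> label set" where
  "uncut_intervals n G =
     {Ival a b | a b. a < b \<and> subinterval (Ival a b) (Ival 1 (n + 1)) \<and>
                      (\<forall>g \<in> junctions n - G. \<not> in_interior g (Ival a b))}"

definition heirs :: "nat \<Rightarrow> nat set \<Rightarrow> label set" where
  "heirs n G = {H \<in> uncut_intervals n G. \<forall>K \<in> uncut_intervals n G. subinterval H K \<longrightarrow> K = H}"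

definition roles :: "nat \<Rightarrow> nat set \<Rightarrow> label set" where
  "roles n G = heirs n G \<union> Junction ` G"

definition heir_of :: "nat \<Rightarrow> nat set \<Rightarrow> nat \<Rightarrow> label" where
  "heir_of n G g = (THE H. H \<in> heirs n G \<and> in_interior g H)"

text \<open>The actor $I_j = [j,j+1)$, for $1 \le j \le n$, starts at \<open>x j\<close>.\<close>

definition initial_state :: "'v set \<Rightarrow> 'v rel \<Rightarrow> nat \<Rightarrow> (nat \<Rightarrow> 'v) \<Rightarrow> bool" where
  "initial_state X rX n x \<longleftrightarrow>
     (\<forall>j\<in>{1..n}. x j \<in> X) \<and>
     (\<forall>i\<in>{1..n}. \<forall>j\<in>{1..n}. i \<le> j \<longrightarrow> (x i, x j) \<in> rX)"

definition final_state :: "'v set \<Rightarrow> 'v rel \<Rightarrow> nat \<Rightarrow> nat set \<Rightarrow> (label \<Rightarrow> 'v) \<Rightarrow> bool" where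
  "final_state Y rY n G y \<longleftrightarrow>
     G \<subseteq> junctions n \<and>
     (\<forall>f \<in> roles n G. y f \<in> Y) \<and>
     (\<forall>H \<in> heirs n G. \<forall>H' \<in> heirs n G. H \<triangleleft> H' \<longrightarrow> (y H, y H') \<in> rY)"

text \<open>If a ghost ends at the position of its heir, both signs are admissible.\<close>

definition ghost_sign ::
  "'v rel \<Rightarrow> nat \<Rightarrow> nat set \<Rightarrow> (label \<Rightarrow> 'v) \<Rightarrow> (nat \<Rightarrow> int) \<Rightarrow> bool" where
  "ghost_sign rY n G y \<epsilon> \<longleftrightarrow>
     (\<forall>g\<in>G. (\<epsilon> g = 1 \<and> (y (Junction g), y (heir_of n G g)) \<in> rY) \<or>
            (\<epsilon> g = -1 \<and> (y (heir_of n G g), y (Junction g)) \<in> rY))"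


section \<open>Performances\<close>

text \<open>A subgraph is a pair of a vertex set and an edge set.\<close>

type_synonym 'v subgraph = "'v set \<times> 'v rel"

definition is_in_tree :: "'v set \<Rightarrow> 'v rel \<Rightarrow> 'v subgraph \<Rightarrow> 'v \<Rightarrow> bool" where
  "is_in_tree V E T r \<longleftrightarrow>
     fst T \<subseteq> V \<and> snd T \<subseteq> E \<and> snd T \<subseteq> fst T \<times> fst T \<and>
     r \<in> fst T \<and>
     (\<forall>v \<in> fst T. (v, r) \<in> (snd T)\<^sup>*) \<and>
     (\<forall>v \<in> fst T - {r}. \<exists>!u. (v, u) \<in> snd T) \<and>
     (\<forall>u. (r, u) \<notin> snd T)"

text \<open>The trajectory from \<open>x\<close> is the unique path from \<open>x\<close> to the root \<open>r\<close> inside the tree \<open>T\<close>;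
  it is only used for vertices \<open>x\<close> of \<open>T\<close>.\<close>

definition trajectory :: "'v subgraph \<Rightarrow> 'v \<Rightarrow> 'v \<Rightarrow> 'v list" where
  "trajectory T x r = (THE p. is_path (fst T) (snd T) x p r)"

definition actors_in :: "nat \<Rightarrow> label \<Rightarrow> nat set" where
  "actors_in n H = {j \<in> {1..n}. subinterval (actor j) H}"

text \<open>Families of trees and of ghost paths are extensional functions, so that each family is
  counted once.\<close>

definition genealogy_forest ::
  "'v set \<Rightarrow> 'v rel \<Rightarrow> nat \<Rightarrow> nat set \<Rightarrow> (nat \<Rightarrow> 'v) \<Rightarrow> (label \<Rightarrow> 'v) \<Rightarrow> (label \<Rightarrow> 'v subgraph) \<Rightarrow> bool"
where
  "genealogy_forest V E n G x y T \<longleftrightarrow>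
     T \<in> extensional (heirs n G) \<and>
     (\<forall>H \<in> heirs n G.
        is_in_tree V E (T H) (y H) \<and>
        x ` actors_in n H \<subseteq> fst (T H) \<and>
        fst (T H) = (\<Union>j \<in> actors_in n H. set (trajectory (T H) (x j) (y H))) \<and>
        snd (T H) = (\<Union>j \<in> actors_in n H. set (path_edges (trajectory (T H) (x j) (y H))))) \<and>
     (\<forall>H \<in> heirs n G. \<forall>H' \<in> heirs n G. H \<noteq> H' \<longrightarrow> fst (T H) \<inter> fst (T H') = {})"

text \<open>The label of a vertex is represented by the set of indices of the actors whose trajectories
  pass through it. Such a union of actors has the junction \<open>g\<close> in its interior iff it contains both
  $[g-1,g)$ and $[g,g+1)$.\<close>

definition vertex_label ::
  "nat \<Rightarrow> nat set \<Rightarrow> (nat \<Rightarrow> 'v) \<Rightarrow> (label \<Rightarrow> 'v) \<Rightarrow> (label \<Rightarrow> 'v subgraph) \<Rightarrow> 'v \<Rightarrow> nat set" where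
  "vertex_label n G x y T v =
     (\<Union>H \<in> heirs n G. {j \<in> actors_in n H. v \<in> set (trajectory (T H) (x j) (y H))})"

definition coalescence_vertex ::
  "'v rel \<Rightarrow> nat \<Rightarrow> nat set \<Rightarrow> (nat \<Rightarrow> 'v) \<Rightarrow> (label \<Rightarrow> 'v) \<Rightarrow> (label \<Rightarrow> 'v subgraph) \<Rightarrow> nat \<Rightarrow> 'v" where
  "coalescence_vertex leV n G x y T g =
     (let S = {v \<in> (\<Union>H \<in> heirs n G. fst (T H)). {g - 1, g} \<subseteq> vertex_label n G x y T v}
      in THE v. v \<in> S \<and> (\<forall>u \<in> S. (v, u) \<in> leV))"

definition performances ::
  "'v set \<Rightarrow> 'v rel \<Rightarrow> 'v rel \<Rightarrow> nat \<Rightarrow> nat set \<Rightarrow> (nat \<Rightarrow> 'v) \<Rightarrow> (label \<Rightarrow> 'v) \<Rightarrow>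
     ((label \<Rightarrow> 'v subgraph) \<times> (nat \<Rightarrow> 'v list)) set" where
  "performances V E leV n G x y =
     {(T, \<Gamma>). genealogy_forest V E n G x y T \<and> \<Gamma> \<in> extensional G \<and>
        (\<forall>g\<in>G. is_path V E (coalescence_vertex leV n G x y T g) (\<Gamma> g) (y (Junction g)))}"

text \<open>The trees are pairwise vertex-disjoint, so the double product below runs over each edge of the
  forest once.\<close>

definition performance_weight ::
  "('v \<times> 'v \<Rightarrow> 'a::comm_ring_1) \<Rightarrow> nat \<Rightarrow> nat set \<Rightarrow>
     (label \<Rightarrow> 'v subgraph) \<times> (nat \<Rightarrow> 'v list) \<Rightarrow> 'a" where
  "performance_weight w n G P =
     (\<Prod>H \<in> heirs n G. \<Prod>e \<in> snd (fst P H). w e) * (\<Prod>g\<in>G. path_weight w (snd P g))"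

definition partition_function ::
  "'v set \<Rightarrow> 'v rel \<Rightarrow> 'v rel \<Rightarrow> ('v \<times> 'v \<Rightarrow> 'a::comm_ring_1) \<Rightarrow>
     nat \<Rightarrow> nat set \<Rightarrow> (nat \<Rightarrow> 'v) \<Rightarrow> (label \<Rightarrow> 'v) \<Rightarrow> 'a" where
  "partition_function V E leV w n G x y =
     (\<Sum>P \<in> performances V E leV n G x y. performance_weight w n G P)"


section \<open>The matrix\<close>

text \<open>Since exactly one of $I \triangleleft g$ and $g \triangleleft I$ holds for an actor $I$ and a junction $g$, the
  last case below is $g \triangleleft I$.\<close>

definition matrix_entry ::
  "'v set \<Rightarrow> 'v rel \<Rightarrow> ('v \<times> 'v \<Rightarrow> 'a::comm_ring_1) \<Rightarrow>
     (nat \<Rightarrow> 'v) \<Rightarrow> (label \<Rightarrow> 'v) \<Rightarrow> (nat \<Rightarrow> int) \<Rightarrow> nat \<Rightarrow> label \<Rightarrow> 'a" where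
  "matrix_entry V E w x y \<epsilon> j f =
     (case f of
        Ival a b \<Rightarrow> path_sum V E w (x j) (y f)
      | Junction g \<Rightarrow>
          if actor j \<triangleleft> Junction g
          then - (of_bool (\<epsilon> g = -1) * path_sum V E w (x j) (y f))
          else of_bool (\<epsilon> g = 1) * path_sum V E w (x j) (y f))"

text \<open>As \<open>label_min\<close> is a bijection from the roles to $\{1,\dots,n\}$ (shown below), the $k$-th role
  in min-order is the one with minimum $k$.\<close>

definition role_at :: "nat \<Rightarrow> nat set \<Rightarrow> nat \<Rightarrow> label" where
  "role_at n G k = the_inv_into (roles n G) label_min k"

text \<open>Matrix indices start at 0, while actors and role minima start at 1.\<close>

definition performance_matrix ::
  "'v set \<Rightarrow> 'v rel \<Rightarrow> ('v \<times> 'v \<Rightarrow> 'a::comm_ring_1) \<Rightarrow>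
     nat \<Rightarrow> nat set \<Rightarrow> (nat \<Rightarrow> 'v) \<Rightarrow> (label \<Rightarrow> 'v) \<Rightarrow> (nat \<Rightarrow> int) \<Rightarrow> 'a mat" where
  "performance_matrix V E w n G x y \<epsilon> =
     mat n n (\<lambda>(i, k). matrix_entry V E w x y \<epsilon> (i + 1) (role_at n G (k + 1)))"

lemma heirs_iff:
  assumes "G \<subseteq> junctions n"
  shows "Ival a b \<in> heirs n G \<longleftrightarrow>
     1 \<le> a \<and> a < b \<and> b \<le> n + 1 \<and> (\<forall>g \<in> junctions n - G. \<not> (a < g \<and> g < b)) \<and>
     (a = 1 \<or> a \<in> junctions n - G) \<and> (b = n + 1 \<or> b \<in> junctions n - G)"
    (is "?L \<longleftrightarrow> ?R")
proof
  assume L: ?L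
  then have 1: "1 \<le> a" "a < b" "b \<le> n + 1" "\<forall>g \<in> junctions n - G. \<not> (a < g \<and> g < b)"
    by (auto simp: heirs_def uncut_intervals_def)
  have mx: "c = a \<and> d = b" if "Ival c d \<in> uncut_intervals n G" "c \<le> a" "b \<le> d" for c d
    using L that by (force simp: heirs_def)
  have "a = 1 \<or> a \<in> junctions n - G"
  proof (rule ccontr)
    assume *: "\<not> ?thesis"
    then have "\<forall>g \<in> junctions n - G. \<not> (a - 1 < g \<and> g < b)"
    proof (intro ballI notI)
      fix g assume g: "g \<in> junctions n - G" "a - 1 < g \<and> g < b"
      have "g \<noteq> a" using * g(1) by blast
      then have "a < g" using g(2) by linarith
      then show False using 1(4) g by blast
    qed
    then have "Ival (a - 1) b \<in> uncut_intervals n G"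
      using 1 * by (auto simp: uncut_intervals_def)
    from mx[OF this] 1 show False by simp
  qed
  moreover have "b = n + 1 \<or> b \<in> junctions n - G"
  proof (rule ccontr)
    assume *: "\<not> ?thesis"
    then have "\<forall>g \<in> junctions n - G. \<not> (a < g \<and> g < b + 1)"
    proof (intro ballI notI)
      fix g assume g: "g \<in> junctions n - G" "a < g \<and> g < b + 1"
      have "g \<noteq> b" using * g(1) by blast
      then have "g < b" using g(2) by linarith
      then show False using 1(4) g by blast
    qed
    then have "Ival a (b + 1) \<in> uncut_intervals n G"
      using 1 * by (auto simp: uncut_intervals_def)
    from mx[OF this] 1 show False by simp
  qed
  ultimately show ?R using 1 by blast
next
  assume R: ?R
  have "c = a \<and> d = b" if "Ival c d \<in> uncut_intervals n G" "c \<le> a" "b \<le> d" for c d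
  proof -
    have cd: "1 \<le> c" "d \<le> n + 1" "\<forall>g \<in> junctions n - G. \<not> (c < g \<and> g < d)"
      using that by (auto simp: uncut_intervals_def)
    have "c = a"
    proof (rule ccontr)
      assume "c \<noteq> a"
      then have "c < a" "a < d" "a \<noteq> 1" using that(2,3) R cd(1) by linarith+
      then show False using R cd(3) by blast
    qed
    moreover have "d = b"
    proof (rule ccontr)
      assume "d \<noteq> b"
      then have "c < b" "b < d" "b \<noteq> n + 1" using that(2,3) R cd(2) by linarith+
      then show False using R cd(3) by blast
    qed
    ultimately show ?thesis ..
  qed
  then show ?L using R by (auto simp: heirs_def uncut_intervals_def)
qed

lemma heirs_Ival: "H \<in> heirs n G \<Longrightarrow> \<exists>a b. H = Ival a b"
  by (auto simp: heirs_def uncut_intervals_def)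

lemma heir_at_unique:
  assumes "G \<subseteq> junctions n" "Ival a b \<in> heirs n G" "Ival c d \<in> heirs n G"
    "max a c < min b d"
  shows "a = c \<and> b = d"
proof -
  have *: "a' \<le> c' \<and> d' \<le> b'"
    if "Ival a' b' \<in> heirs n G" "Ival c' d' \<in> heirs n G" "a' < d'" "c' < b'" for a' b' c' d'
  proof -
    note h = that(1,2)[unfolded heirs_iff[OF assms(1)]]
    have "\<not> c' < a'"
    proof
      assume "c' < a'"
      then have "a' \<in> junctions n - G" using h by auto
      then show False using h(2) that(3) \<open>c' < a'\<close> by blast
    qed
    moreover have "\<not> b' < d'"
    proof
      assume "b' < d'"
      then have "b' \<in> junctions n - G" using h by auto
      then show False using h(2) that(4) \<open>b' < d'\<close> by blast
    qed
    ultimately show ?thesis by linarith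
  qed
  show ?thesis
    using *[OF assms(2,3)] *[OF assms(3,2)] assms(4) by simp
qed

lemma heir_at_exists:
  assumes G: "G \<subseteq> junctions n" and k: "k \<in> {1..n}"
  shows "\<exists>a b. Ival a b \<in> heirs n G \<and> a \<le> k \<and> k < b"
proof -
  define a where "a = Max (insert 1 {g \<in> junctions n - G. g \<le> k})"
  define b where "b = Min (insert (n + 1) {g \<in> junctions n - G. k < g})"
  have f: "finite (junctions n)" by (simp add: junctions_def)
  have a: "a \<in> insert 1 {g \<in> junctions n - G. g \<le> k}" unfolding a_def by (rule Max_in) (use f in auto)
  have b: "b \<in> insert (n + 1) {g \<in> junctions n - G. k < g}" unfolding b_def by (rule Min_in) (use f in auto)
  have a': "g \<le> a" if "g \<in> junctions n - G" "g \<le> k" for g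
    unfolding a_def by (rule Max_ge) (use f that in auto)
  have b': "b \<le> g" if "g \<in> junctions n - G" "k < g" for g
    unfolding b_def by (rule Min_le) (use f that in auto)
  have "a \<le> k" "k < b" "1 \<le> a" "b \<le> n + 1" using a b k by (auto simp: junctions_def)
  moreover have "\<forall>g \<in> junctions n - G. \<not> (a < g \<and> g < b)" using a' b' by (meson not_le)
  ultimately have "Ival a b \<in> heirs n G" unfolding heirs_iff[OF G] using a b by auto
  with \<open>a \<le> k\<close> \<open>k < b\<close> show ?thesis by blast
qed

lemma bij_betw_label_min:
  assumes G: "G \<subseteq> junctions n"
  shows "bij_betw label_min (roles n G) {1..n}"
proof (rule bij_betwI')
  fix f h assume "f \<in> roles n G" "h \<in> roles n G"
  moreover have "f' = h'"
    if f'h': "f' \<in> heirs n G" "h' \<in> heirs n G" "label_min f' = label_min h'" for f' h'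
  proof -
    obtain a b c d where *: "f' = Ival a b" "h' = Ival c d"
      using heirs_Ival[OF f'h'(1)] heirs_Ival[OF f'h'(2)] by blast
    have "a = c" "a < b" "c < d" using that by (simp_all add: * heirs_iff[OF G])
    then show ?thesis using heir_at_unique[OF G, of a b c d] that(1,2) by (simp add: *)
  qed
  moreover have "label_min h' \<notin> G" if h': "h' \<in> heirs n G" for h'
  proof -
    obtain a b where *: "h' = Ival a b" using heirs_Ival[OF h'] by blast
    have "a = 1 \<or> a \<notin> G" using that by (auto simp: * heirs_iff[OF G])
    then show ?thesis using G unfolding * junctions_def by fastforce
  qed
  ultimately show "label_min f = label_min h \<longleftrightarrow> f = h"
    unfolding roles_def by (elim UnE imageE) auto
next
  fix f assume "f \<in> roles n G"
  then show "label_min f \<in> {1..n}"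
    using heirs_Ival[of f n G] G by (auto simp: roles_def heirs_iff[OF G] junctions_def)
next
  fix k assume k: "k \<in> {1..n}"
  then obtain a b where ab: "Ival a b \<in> heirs n G" "a \<le> k" "k < b"
    using heir_at_exists[OF G] by blast
  show "\<exists>f\<in>roles n G. k = label_min f"
  proof (cases "k \<in> G")
    case True
    then show ?thesis by (intro bexI[of _ "Junction k"]) (auto simp: roles_def)
  next
    case False
    have "a = k"
    proof (rule ccontr)
      assume "a \<noteq> k"
      moreover have "1 \<le> a" using ab by (simp add: heirs_iff[OF G])
      ultimately have "k \<in> junctions n - G" using k False ab(2) by (auto simp: junctions_def)
      then show False using ab \<open>a \<noteq> k\<close> by (auto simp: heirs_iff[OF G])
    qed
    then show ?thesis using ab by (intro bexI[of _ "Ival a b"]) (auto simp: roles_def)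
  qed
qed

lemma heir_of:
  assumes G: "G \<subseteq> junctions n" and g: "g \<in> G"
  shows "heir_of n G g \<in> heirs n G" "in_interior g (heir_of n G g)"
proof -
  have "g \<in> {1..n}" using G g by (auto simp: junctions_def)
  then obtain a b where ab: "Ival a b \<in> heirs n G" "a \<le> g" "g < b"
    using heir_at_exists[OF G] by blast
  moreover have "a \<noteq> g" using ab g G by (auto simp: heirs_iff[OF G] junctions_def)
  ultimately have 1: "Ival a b \<in> heirs n G \<and> in_interior g (Ival a b)" by simp
  have "H = Ival a b" if "H \<in> heirs n G \<and> in_interior g H" for H
    using that 1 heirs_Ival[of H n G] heir_at_unique[OF G] by fastforce
  from theI[of "\<lambda>H. H \<in> heirs n G \<and> in_interior g H", OF 1 this]
  show "heir_of n G g \<in> heirs n G" "in_interior g (heir_of n G g)"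
    unfolding heir_of_def by auto
qed

end

theory Submission
  imports Defs
begin

text \<open>
  Summing out the ghost paths turns the partition function into a sum over coalescing families of
  trajectories, with a factor $W(c_g \to y_g)$ for every ghost. Instead of a global sign-reversing
  involution, both this sum and the determinant are shown to satisfy the same recursion, in which the
  live particle at the lowest vertex is moved. If two particles adjacent among the live ones are both
  there, their rows differ only in the column of the ghost $g$ between them, by $W(c_g \to y_g)$, so one
  row and one column can be removed; this is the coalescence of the two. If the lowest particle is
  alone, its row is expanded by its first step; the terms in which it stops at once vanish unless it is
  the last particle of its heir and stops there, because it separates the others by (P1) and the signs
  of the ghosts leave too few roles on one side of it. Finally, (P2) ensures that two particles can only meet
  together with all those between them.
\<close>

section \<open>Determinants over finite index sets\<close>

text \<open>Live particles and open roles are indexed by one set \<open>S\<close> of minima. A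
  merger uses up the right-hand particle and the ghost at the junction, a stop uses up a particle
  and its heir, and each time the two have the same index. Hence only principal minors occur, and no
  cofactor signs have to be tracked. Path sums depend only on positions and coefficients only on
  indices, so the matrix keeps its form while particles move. Planarity, however, speaks of whole
  paths that start in \<open>X\<close>, whereas the recursion sees positions in mid-course. The
  paths travelled so far are therefore carried along; they stay disjoint and strictly below all
  positions, so an intersection forced by planarity cannot lie in the past of one particle and on
  the path of another. As \<open>V\<close> and the out-degrees may be infinite, first steps and the
  termination measure are restricted to the finitely many vertices on paths from a source to a
  target.\<close>

definition set_det :: "('i \<Rightarrow> 'i \<Rightarrow> 'a::comm_ring_1) \<Rightarrow> 'i set \<Rightarrow> 'a" where
  "set_det A S = (\<Sum>\<pi> | \<pi> permutes S. of_int (sign \<pi>) * (\<Prod>k\<in>S. A k (\<pi> k)))"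

lemma set_det_empty [simp]: "set_det A {} = 1"
  by (simp add: set_det_def)

lemma set_det_cong:
  assumes "\<And>k m. k \<in> S \<Longrightarrow> m \<in> S \<Longrightarrow> A k m = B k m"
  shows "set_det A S = set_det B S"
  unfolding set_det_def using assms
  by (intro sum.cong refl arg_cong[where f = "(*) _"] prod.cong) (auto simp: permutes_in_image)

text \<open>Composition with the transposition of \<open>i\<close> and \<open>j\<close> negates the
  term of a permutation. Since 2 may be a zero divisor in the ring, equality of the sum with its
  negative would not suffice; the even permutations are matched with the odd ones instead.\<close>

lemma set_det_equal_rows:
  assumes "finite S" "i \<in> S" "j \<in> S" "i \<noteq> j" and eq: "\<And>m. m \<in> S \<Longrightarrow> A i m = A j m"
  shows "set_det A S = 0"
proof -
  define t where "t = Transposition.transpose i j"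
  have t: "t permutes S" using assms by (simp add: t_def permutes_swap_id)
  have tt: "t \<circ> t = id" by (simp add: t_def)
  define F where "F = (\<lambda>\<pi>. of_int (sign \<pi>) * (\<Prod>k\<in>S. A k (\<pi> k)))"
  define P where "P = {\<pi>. \<pi> permutes S}"
  have fin: "finite P" using assms by (simp add: P_def finite_permutations)
  have sg: "sign (\<pi> \<circ> t) = - sign \<pi>" if "\<pi> \<in> P" for \<pi>
    using that t assms by (subst sign_compose)
      (auto simp: P_def t_def sign_swap_id permutation_permutes permutation_swap_id)
  have FF: "F (\<pi> \<circ> t) = - F \<pi>" if \<pi>: "\<pi> \<in> P" for \<pi>
  proof -
    have "(\<Prod>k\<in>S. A k ((\<pi> \<circ> t) k)) = (\<Prod>k\<in>S. A (t k) (\<pi> k))"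
      using tt by (intro prod.reindex_bij_witness[of _ t t])
        (auto simp: permutes_in_image[OF t] fun_eq_iff)
    also have "\<dots> = (\<Prod>k\<in>S. A k (\<pi> k))"
      using \<pi> eq by (intro prod.cong refl)
        (auto simp: t_def transpose_def P_def permutes_in_image)
    finally show ?thesis using sg[OF \<pi>] by (simp add: F_def)
  qed
  have "sum F {\<pi>\<in>P. sign \<pi> \<noteq> 1} = sum (\<lambda>\<pi>. F (\<pi> \<circ> t)) {\<pi>\<in>P. sign \<pi> = 1}"
  proof (rule sum.reindex_bij_witness[of _ "\<lambda>\<pi>. \<pi> \<circ> t" "\<lambda>\<pi>. \<pi> \<circ> t"])
    show "\<pi> \<circ> t \<in> {\<pi>\<in>P. sign \<pi> = 1}" if "\<pi> \<in> {\<pi>\<in>P. sign \<pi> \<noteq> 1}" for \<pi>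
      using that sg[of \<pi>] t permutes_compose by (cases \<pi> rule: sign_cases) (auto simp: P_def)
    show "\<pi> \<circ> t \<in> {\<pi>\<in>P. sign \<pi> \<noteq> 1}" if "\<pi> \<in> {\<pi>\<in>P. sign \<pi> = 1}" for \<pi>
      using that sg[of \<pi>] t permutes_compose by (auto simp: P_def)
  qed (use tt in \<open>auto simp: o_assoc[symmetric]\<close>)
  also have "\<dots> = - sum F {\<pi>\<in>P. sign \<pi> = 1}"
    unfolding sum_negf[symmetric] by (intro sum.cong refl FF) auto
  finally have "sum F {\<pi>\<in>P. sign \<pi> = 1} + sum F {\<pi>\<in>P. sign \<pi> \<noteq> 1} = 0" by simp
  moreover have "P = {\<pi>\<in>P. sign \<pi> = 1} \<union> {\<pi>\<in>P. sign \<pi> \<noteq> 1}" by auto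
  ultimately have "sum F P = 0"
    using fin by (subst (asm) sum.union_disjoint[symmetric]) auto
  then show ?thesis by (simp add: set_det_def F_def P_def)
qed

text \<open>The permutations of \<open>S\<close> that fix \<open>i\<close> are those of
  \<open>S - {i}\<close>, with the same sign. The hypothesis concerns whole products because, when a
  particle stops, a term may vanish through a factor in another row.\<close>

lemma set_det_expand_diagonal:
  assumes "finite S" "i \<in> S"
    and "\<And>\<pi>. \<pi> permutes S \<Longrightarrow> \<pi> i \<noteq> i \<Longrightarrow> (\<Prod>k\<in>S. A k (\<pi> k)) = 0"
  shows "set_det A S = A i i * set_det A (S - {i})"
proof -
  have sub: "{\<pi>. \<pi> permutes S - {i}} \<subseteq> {\<pi>. \<pi> permutes S}"
    by (auto intro: permutes_subset)
  have "set_det A S = (\<Sum>\<pi> | \<pi> permutes S - {i}. of_int (sign \<pi>) * (\<Prod>k\<in>S. A k (\<pi> k)))"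
    unfolding set_det_def
  proof (rule sum.mono_neutral_right)
    show "\<forall>\<pi>\<in>{\<pi>. \<pi> permutes S} - {\<pi>. \<pi> permutes S - {i}}. 
            of_int (sign \<pi>) * (\<Prod>k\<in>S. A k (\<pi> k)) = 0"
    proof
      fix \<pi> assume \<pi>: "\<pi> \<in> {\<pi>. \<pi> permutes S} - {\<pi>. \<pi> permutes S - {i}}"
      then have "\<pi> i \<noteq> i" using permutes_superset[of \<pi> S "S - {i}"] by auto
      then show "of_int (sign \<pi>) * (\<Prod>k\<in>S. A k (\<pi> k)) = 0" using \<pi> assms(3) by simp
    qed
  qed (use assms sub finite_permutations in auto)
  also have "\<dots> = (\<Sum>\<pi> | \<pi> permutes S - {i}. A i i * (of_int (sign \<pi>) * (\<Prod>k\<in>S - {i}. A k (\<pi> k))))"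
    using assms by (intro sum.cong refl) (auto simp: prod.remove permutes_not_in)
  finally show ?thesis by (simp add: set_det_def sum_distrib_left)
qed

text \<open>The shape fits a row of path sums split by first step: \<open>f\<close> collects the
  paths of length zero and \<open>N\<close> the next vertices.\<close>

lemma set_det_row_linear:
  assumes "finite S" "i \<in> S"
  shows "set_det (A(i := \<lambda>m. f m + (\<Sum>u\<in>N. c u * B u m))) S =
    set_det (A(i := f)) S + (\<Sum>u\<in>N. c u * set_det (A(i := B u)) S)"
proof -
  have *: "(\<Prod>k\<in>S. (A(i := r)) k (\<pi> k)) = r (\<pi> i) * (\<Prod>k\<in>S - {i}. A k (\<pi> k))" for r \<pi>
    using assms by (subst prod.remove[of S i]) (auto intro!: prod.cong)
  have "(\<Sum>u\<in>N. c u * set_det (A(i := B u)) S) =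
      (\<Sum>\<pi> | \<pi> permutes S. \<Sum>u\<in>N. c u * (of_int (sign \<pi>) * (B u (\<pi> i) * (\<Prod>k\<in>S - {i}. A k (\<pi> k)))))"
    unfolding set_det_def * by (simp only: sum_distrib_left sum.swap[of _ N])
  then show ?thesis
    unfolding set_det_def *
    by (simp add: sum.distrib[symmetric] distrib_right distrib_left sum_distrib_left sum_distrib_right mult_ac)
qed

lemma set_det_zero_row:
  assumes "finite S" "i \<in> S" "\<And>m. m \<in> S \<Longrightarrow> A i m = 0"
  shows "set_det A S = 0"
proof -
  have "(\<Prod>k\<in>S. A k (\<pi> k)) = 0" if "\<pi> permutes S" for \<pi>
    using that assms permutes_in_image[OF that, of i] by (intro prod_zero) auto
  then show ?thesis by (simp add: set_det_def)
qed

lemma bij_betw_map_permutation: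
  assumes "bij_betw f A B"
  shows "bij_betw (map_permutation A f) {\<pi>. \<pi> permutes A} {\<pi>. \<pi> permutes B}"
  using assms bij_betw_inv_into[OF assms]
  by (intro bij_betw_byWitness[where f' = "map_permutation B (inv_into A f)"])
    (auto simp: map_permutation_compose_inv[OF assms] bij_betw_inv_into_left[OF assms]
      bij_betw_inv_into_right[OF assms] map_permutation_permutes
      intro!: map_permutation_compose_inv[of "inv_into A f" B A])

text \<open>Conjugation by \<open>Suc\<close> turns the permutations of \<open>{0..<n}\<close> into
  those of \<open>{1..n}\<close> and preserves signs.\<close>

lemma det_mat_eq_set_det:
  "det (mat n n (\<lambda>(i, k). A (i + 1) (k + 1))) = set_det A {1..n}"
proof -
  define s where "s = map_permutation {0..<n} Suc"
  have im: "Suc ` {0..<n} = {1..n}" by (auto simp: image_iff Suc_le_eq intro!: bexI[of _ "_ - 1"])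
  have bij: "bij_betw Suc {0..<n} {1..n}" using im by (simp add: bij_betw_def)
  have "set_det A {1..n} =
      (\<Sum>\<pi> | \<pi> permutes {0..<n}. of_int (sign (s \<pi>)) * (\<Prod>k\<in>{1..n}. A k (s \<pi> k)))"
    unfolding set_det_def
    by (rule sum.reindex_bij_betw[symmetric], rule bij_betw_map_permutation[OF bij, folded s_def])
  also have "\<dots> = (\<Sum>\<pi> | \<pi> permutes {0..<n}. of_int (sign \<pi>) * (\<Prod>k\<in>{0..<n}. A (k + 1) (\<pi> k + 1)))"
  proof (intro sum.cong refl)
    fix \<pi> assume "\<pi> \<in> {\<pi>. \<pi> permutes {0..<n}}"
    then have \<pi>: "\<pi> permutes {0..<n}" by simp
    have "(\<Prod>k\<in>{1..n}. A k (s \<pi> k)) = (\<Prod>k\<in>{0..<n}. A (Suc k) (s \<pi> (Suc k)))"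
      unfolding im[symmetric] by (subst prod.reindex) auto
    also have "\<dots> = (\<Prod>k\<in>{0..<n}. A (k + 1) (\<pi> k + 1))"
      unfolding s_def using \<pi> by (intro prod.cong) (auto simp: map_permutation_apply)
    finally show "of_int (sign (s \<pi>)) * (\<Prod>k\<in>{1..n}. A k (s \<pi> k)) = 
        of_int (sign \<pi>) * (\<Prod>k\<in>{0..<n}. A (k + 1) (\<pi> k + 1))"
      using \<pi> by (simp add: s_def sign_map_permutation)
  qed
  finally show ?thesis
    by (subst det_def'[of _ n]) (auto intro!: sum.cong prod.cong simp: permutes_in_image)
qed

text \<open>Pigeonhole principle for stops: \<open>L\<close> will be the particles on one side of a
  stopped one, and \<open>a\<close> an index among theirs whose role none of them can take.\<close>

lemma permutes_not_shrinking:
  assumes "\<pi> permutes S" "finite S" "L \<subseteq> S" "a \<in> L" "\<And>k. k \<in> L \<Longrightarrow> \<pi> k \<in> L - {a}"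
  shows False
proof -
  have fin: "finite L" using assms finite_subset by blast
  have "card L = card (\<pi> ` L)" using assms(1) by (simp add: card_image permutes_inj_on)
  also have "\<dots> \<le> card (L - {a})" using assms(5) fin by (intro card_mono) auto
  also have "\<dots> < card L" using fin assms(4) by (rule card_Diff1_less)
  finally show False by simp
qed

section \<open>Paths\<close>

lemma path_edges_Cons: "path_edges (v # p) = (if p = [] then [] else (v, hd p) # path_edges p)"
  by (cases p) (auto simp: path_edges_def)

lemma path_edges_Nil [simp]: "path_edges [] = []"
  by (simp add: path_edges_def)

lemma set_path_edges: "set (path_edges p) \<subseteq> set p \<times> set p"
  by (induction p) (auto simp: path_edges_Cons)

lemma is_path_iff_edges:
  "is_path V E a p b \<longleftrightarrow>
     p \<noteq> [] \<and> hd p = a \<and> last p = b \<and> set p \<subseteq> V \<and> set (path_edges p) \<subseteq> E"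
proof -
  have "successively (\<lambda>u v. (u, v) \<in> E) p \<longleftrightarrow> set (path_edges p) \<subseteq> E" for p
    by (induction p) (auto simp: path_edges_Cons successively_Cons)
  then show ?thesis by (simp add: is_path_def)
qed

lemma is_path_Cons:
  "is_path V E a (v # p) b \<longleftrightarrow>
     v = a \<and> a \<in> V \<and> (if p = [] then b = a else (a, hd p) \<in> E \<and> is_path V E (hd p) p b)"
  by (auto simp: is_path_def successively_Cons)

lemma is_path_ConsI: "(a, u) \<in> E \<Longrightarrow> a \<in> V \<Longrightarrow> is_path V E u p b \<Longrightarrow> is_path V E a (a # p) b"
  by (auto simp: is_path_def successively_Cons)

text \<open>The common vertex \<open>b\<close> is dropped once, so a past \<open>q\<close> that
  excludes the current position can be followed by any path from that position.\<close>

lemma is_path_append: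
  assumes "is_path V E a (q @ [b]) b" "is_path V E b p c"
  shows "is_path V E a (q @ p) c"
  using assms by (cases p) (auto simp: is_path_def successively_append_iff hd_append successively_Cons)

lemma is_path_mono:
  assumes "is_path V E a p b" "V \<subseteq> V'" "E \<subseteq> E'"
  shows "is_path V' E' a p b"
  using assms by (auto simp: is_path_iff_edges)

lemma path_start_mem: "is_path V E a p b \<Longrightarrow> a \<in> set p"
  by (auto simp: is_path_def)

lemma path_end_mem: "is_path V E a p b \<Longrightarrow> b \<in> set p"
  by (auto simp: is_path_def)

lemma path_reaches:
  assumes "is_path V E a p b" "v \<in> set p"
  shows "(a, v) \<in> E\<^sup>*" "(v, b) \<in> E\<^sup>*"
proof -
  have "\<forall>v\<in>set p. (a, v) \<in> E\<^sup>* \<and> (v, b) \<in> E\<^sup>*" using assms(1)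
  proof (induction p arbitrary: a)
    case Nil
    then show ?case by simp
  next
    case (Cons u p)
    show ?case
    proof (cases "p = []")
      case True
      then show ?thesis using Cons.prems by (auto simp: is_path_Cons)
    next
      case False
      then have *: "u = a" "(a, hd p) \<in> E" "is_path V E (hd p) p b"
        using Cons.prems by (auto simp: is_path_Cons)
      have "\<forall>v\<in>set p. (a, v) \<in> E\<^sup>* \<and> (v, b) \<in> E\<^sup>*"
        using Cons.IH[OF *(3)] *(2) by (meson converse_rtrancl_into_rtrancl)
      moreover from this have "(a, b) \<in> E\<^sup>*" using path_end_mem[OF *(3)] by blast
      ultimately show ?thesis using * by auto
    qed
  qed
  then show "(a, v) \<in> E\<^sup>*" "(v, b) \<in> E\<^sup>*" using assms(2) by auto
qed

lemma path_exit:
  assumes "v \<in> set p" "v \<noteq> last p"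
  shows "\<exists>u. (v, u) \<in> set (path_edges p)"
  using assms by (induction p) (auto simp: path_edges_Cons split: if_splits)

lemma rtrancl_imp_path:
  assumes "(a, b) \<in> E\<^sup>*" "E \<subseteq> V \<times> V" "b \<in> V"
  shows "\<exists>p. is_path V E a p b"
  using assms(1)
proof (induction rule: converse_rtrancl_induct)
  case base
  show ?case using assms by (intro exI[of _ "[b]"]) (auto simp: is_path_Cons)
next
  case (step a c)
  then obtain p where "is_path V E c p b" by blast
  then show ?case using step assms by (intro exI[of _ "a # p"] is_path_ConsI) auto
qed

text \<open>Each next vertex is forced, and as \<open>b\<close> has no exit, neither path can run on
  past it.\<close>

lemma single_valued_path_unique:
  assumes "single_valued E" "\<And>u. (b, u) \<notin> E" "is_path V E a p b" "is_path V E a q b"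
  shows "p = q"
  using assms(3,4)
proof (induction p arbitrary: a q)
  case Nil
  then show ?case by (simp add: is_path_def)
next
  case (Cons v p)
  obtain v' q' where q: "q = v' # q'" using Cons.prems by (cases q) (auto simp: is_path_def)
  show ?case
  proof (cases "p = [] \<or> q' = []")
    case True
    then show ?thesis using Cons.prems assms(2) by (auto simp: q is_path_Cons split: if_splits)
  next
    case False
    then have "hd p = hd q'" using Cons.prems assms(1) by (auto simp: q is_path_Cons single_valued_def)
    then show ?thesis using Cons.IH[of "hd p" q'] Cons.prems False by (auto simp: q is_path_Cons)
  qed
qed

section \<open>Paths in a spacetime graph\<close>

locale spacetime =
  fixes V :: "'v set" and E leV :: "'v rel"
  assumes spacetime: "spacetime_graph V E leV"
begin

lemma edges_in: "E \<subseteq> V \<times> V"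
  and acyclic_edges: "acyclic E"
  and order: "linear_order_on V leV"
  and reach_le: "E\<^sup>+ \<subseteq> leV"
  using spacetime by (auto simp: spacetime_graph_def)

lemma leV_refl: "v \<in> V \<Longrightarrow> (v, v) \<in> leV"
  using order by (auto simp: order_on_defs refl_on_def)

lemma leV_trans: "(u, v) \<in> leV \<Longrightarrow> (v, t) \<in> leV \<Longrightarrow> (u, t) \<in> leV"
  using order by (auto simp: order_on_defs dest: transD)

lemma leV_antisym: "(u, v) \<in> leV \<Longrightarrow> (v, u) \<in> leV \<Longrightarrow> u = v"
  using order by (auto simp: order_on_defs dest: antisymD)

lemma leV_total: "u \<in> V \<Longrightarrow> v \<in> V \<Longrightarrow> (u, v) \<in> leV \<or> (v, u) \<in> leV"
  using order leV_refl[of u] by (auto simp: order_on_defs total_on_def)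

lemma edge_less: "(u, v) \<in> E \<Longrightarrow> (u, v) \<in> leV \<and> u \<noteq> v"
  using reach_le acyclic_edges by (auto simp: acyclic_def)

lemma reaches_le: "(u, v) \<in> E\<^sup>* \<Longrightarrow> u \<in> V \<Longrightarrow> (u, v) \<in> leV"
  using reach_le leV_refl by (auto simp: rtrancl_eq_or_trancl)

lemma path_in:
  assumes "is_path V E a p b"
  shows "a \<in> V" "b \<in> V" "set p \<subseteq> V"
  using assms by (auto simp: is_path_def)

lemma path_le:
  assumes "is_path V E a p b" "v \<in> set p"
  shows "(a, v) \<in> leV" "(v, b) \<in> leV"
  using path_reaches[OF assms] path_in[OF assms(1)] assms(2) by (auto intro: reaches_le)

lemma path_not_back:
  assumes "is_path V E a p b" "(b, u) \<in> E"
  shows "u \<notin> set p"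
proof
  assume "u \<in> set p"
  then have "(u, b) \<in> leV" using path_le assms by blast
  then show False using edge_less[OF assms(2)] leV_antisym by blast
qed

lemma closed_path: "is_path V E a p a \<longleftrightarrow> a \<in> V \<and> p = [a]"
proof
  assume p: "is_path V E a p a"
  then obtain q where q: "p = a # q" by (cases p) (auto simp: is_path_def)
  have "q = []"
  proof (rule ccontr)
    assume "q \<noteq> []"
    then have "(a, hd q) \<in> E" "hd q \<in> set p" using p by (auto simp: q is_path_Cons)
    then show False using path_not_back[OF p] by blast
  qed
  then show "a \<in> V \<and> p = [a]" using p q by (auto simp: is_path_def)
qed (auto simp: is_path_def)

lemma finite_paths: "finite {p. is_path V E a p b}"
proof (cases "a \<in> V \<and> b \<in> V")
  case True
  then show ?thesis using spacetime by (auto simp: spacetime_graph_def)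
next
  case False
  then have "{p. is_path V E a p b} = {}" using path_in by blast
  then show ?thesis by simp
qed

lemma paths_by_first_step:
  assumes "a \<in> V" "\<And>u. u \<in> N \<Longrightarrow> (a, u) \<in> E"
    and "\<And>u p. (a, u) \<in> E \<Longrightarrow> is_path V E u p b \<Longrightarrow> u \<in> N"
  shows "{p. is_path V E a p b} =
    (if a = b then {[a]} else {}) \<union> (\<Union>u\<in>N. (#) a ` {p. is_path V E u p b})" (is "?L = ?R")
proof (intro subset_antisym subsetI)
  fix p assume "p \<in> ?L"
  then have p: "is_path V E a p b" by simp
  then obtain q where q: "p = a # q" by (cases p) (auto simp: is_path_def)
  show "p \<in> ?R"
  proof (cases "q = []")
    case True
    then show ?thesis using p by (auto simp: q is_path_Cons)
  next
    case False
    then have "(a, hd q) \<in> E" "is_path V E (hd q) q b" using p by (auto simp: q is_path_Cons)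
    then show ?thesis using assms(3) by (auto simp: q)
  qed
next
  fix p assume "p \<in> ?R"
  then consider "a = b" "p = [a]" | u q where "u \<in> N" "is_path V E u q b" "p = a # q"
    by (auto split: if_splits)
  then show "p \<in> ?L"
    by cases (use assms(1,2) in \<open>auto simp: closed_path intro: is_path_ConsI\<close>)
qed

text \<open>A vertex may have infinitely many successors, so the sum runs over any finite set of
  successors that includes all those from which \<open>b\<close> can be reached.\<close>

lemma path_sum_by_first_step:
  assumes "a \<in> V" "finite N" "\<And>u. u \<in> N \<Longrightarrow> (a, u) \<in> E"
    and "\<And>u p. (a, u) \<in> E \<Longrightarrow> is_path V E u p b \<Longrightarrow> u \<in> N"
  shows "path_sum V E w a b = of_bool (a = b) + (\<Sum>u\<in>N. w (a, u) * path_sum V E w u b)"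
proof -
  let ?P = "\<lambda>u. {p. is_path V E u p b}"
  have hd: "hd p = u \<and> p \<noteq> []" if "p \<in> ?P u" for u p using that by (auto simp: is_path_def)
  have eq: "?P a = (if a = b then {[a]} else {}) \<union> (\<Union>u\<in>N. (#) a ` ?P u)"
    by (rule paths_by_first_step) (use assms in blast)+
  have "path_sum V E w a b =
      (\<Sum>p\<in>(if a = b then {[a]} else {}). path_weight w p) +
      (\<Sum>p\<in>(\<Union>u\<in>N. (#) a ` ?P u). path_weight w p)"
    unfolding path_sum_def eq using assms(2) hd by (intro sum.union_disjoint) (auto simp: finite_paths)
  also have "(\<Sum>p\<in>(\<Union>u\<in>N. (#) a ` ?P u). path_weight w p) =
      (\<Sum>u\<in>N. \<Sum>p\<in>(#) a ` ?P u. path_weight w p)"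
    using assms(2) hd by (intro sum.UNION_disjoint) (auto simp: finite_paths)
  also have "\<dots> = (\<Sum>u\<in>N. w (a, u) * path_sum V E w u b)"
    unfolding path_sum_def sum_distrib_left
  proof (rule sum.cong[OF refl])
    show "sum (path_weight w) ((#) a ` ?P u) = (\<Sum>p\<in>?P u. w (a, u) * path_weight w p)" for u
      using hd by (subst sum.reindex) (auto simp: path_weight_def path_edges_Cons intro!: sum.cong)
  qed
  finally show ?thesis by (auto simp: path_weight_def path_edges_def)
qed

end

lemma (in spacetime) ex_least:
  assumes "finite C" "C \<noteq> {}" "C \<subseteq> V"
  shows "\<exists>v\<in>C. \<forall>t\<in>C. (v, t) \<in> leV"
  using assms
proof (induction C rule: finite_ne_induct)
  case (singleton v)
  then show ?case using leV_refl by auto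
next
  case (insert t C)
  then obtain v where v: "v \<in> C" "\<forall>t\<in>C. (v, t) \<in> leV" by blast
  show ?case
  proof (cases "(v, t) \<in> leV")
    case True
    then show ?thesis using v by auto
  next
    case False
    then have "(t, v) \<in> leV" using leV_total insert.prems v by blast
    then show ?thesis using v leV_trans leV_refl insert.prems by blast
  qed
qed

section \<open>Coalescing families of trajectories\<close>

text \<open>An heir is represented by its left endpoint: \<open>heir_min G m\<close> is that of the heir containing
  actor \<open>m\<close>.\<close>

definition heir_min :: "nat set \<Rightarrow> nat \<Rightarrow> nat" where
  "heir_min G m = Max {k \<in> {1..m}. k \<notin> G}"

text \<open>For a live ghost index \<open>g\<close> this is the live neighbour to the left, which
  stands in for actor \<open>g - 1\<close> after mergers.\<close>

definition pred_in :: "nat set \<Rightarrow> nat \<Rightarrow> nat" where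
  "pred_in S g = Max {k \<in> S. k < g}"

lemma pred_in_eqI:
  assumes "k \<in> S" "k < g" "\<And>l. l \<in> S \<Longrightarrow> l < g \<Longrightarrow> l \<le> k"
  shows "pred_in S g = k"
  unfolding pred_in_def using assms finite_subset[of "{k \<in> S. k < g}" "{..<g}"]
  by (intro Max_eqI) auto

lemma pred_in:
  assumes "k \<in> S" "k < g"
  shows "pred_in S g \<in> S" "pred_in S g < g" "\<And>l. l \<in> S \<Longrightarrow> l < g \<Longrightarrow> l \<le> pred_in S g"
proof -
  have fin: "finite {k \<in> S. k < g}" by (rule finite_subset[of _ "{..<g}"]) auto
  have "pred_in S g \<in> {k \<in> S. k < g}" unfolding pred_in_def using assms fin by (intro Max_in) auto
  then show "pred_in S g \<in> S" "pred_in S g < g" by auto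
  show "l \<le> pred_in S g" if "l \<in> S" "l < g" for l
    unfolding pred_in_def using that fin by (intro Max_ge) auto
qed

text \<open>A role is represented by its minimum: \<open>z m\<close> is the position of the role with minimum \<open>m\<close>, which
  is a ghost iff \<open>m \<in> G\<close>.\<close>

locale casting = spacetime V E leV for V :: "'v set" and E leV +
  fixes w :: "'v \<times> 'v \<Rightarrow> 'a::comm_ring_1"
    and X :: "'v set" and rX :: "'v rel" and Y :: "'v set" and rY :: "'v rel"
    and n :: nat and G :: "nat set" and x z :: "nat \<Rightarrow> 'v" and \<epsilon> :: "nat \<Rightarrow> int"
  assumes planar: "planar_pair V E leV X rX Y rY"
    and initial: "initial_state X rX n x"
    and ghosts: "G \<subseteq> {2..n}"
    and targets: "\<And>m. m \<in> {1..n} \<Longrightarrow> z m \<in> Y"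
    and heirs_ordered: "\<And>k m. k \<in> {1..n} - G \<Longrightarrow> m \<in> {1..n} - G \<Longrightarrow> k \<le> m \<Longrightarrow> (z k, z m) \<in> rY"
    and signs: "\<And>g. g \<in> G \<Longrightarrow> (\<epsilon> g = 1 \<and> (z g, z (heir_min G g)) \<in> rY) \<or>
                   (\<epsilon> g = -1 \<and> (z (heir_min G g), z g) \<in> rY)"
begin

abbreviation heir :: "nat \<Rightarrow> nat" where "heir \<equiv> heir_min G"

lemma heir_props:
  assumes "1 \<le> m"
  shows "1 \<le> heir m" "heir m \<le> m" "heir m \<notin> G" "\<And>k. 1 \<le> k \<Longrightarrow> k \<le> m \<Longrightarrow> k \<notin> G \<Longrightarrow> k \<le> heir m"
proof -
  have "1 \<in> {k \<in> {1..m}. k \<notin> G}" using assms ghosts by auto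
  then have "heir m \<in> {k \<in> {1..m}. k \<notin> G}" unfolding heir_min_def by (intro Max_in) auto
  then show "1 \<le> heir m" "heir m \<le> m" "heir m \<notin> G" by auto
  show "k \<le> heir m" if "1 \<le> k" "k \<le> m" "k \<notin> G" for k
    unfolding heir_min_def using that by (intro Max_ge) auto
qed

lemma heir_fixed: "1 \<le> m \<Longrightarrow> m \<notin> G \<Longrightarrow> heir m = m"
  using heir_props(2)[of m] heir_props(4)[of m m] by simp

lemma heir_less: "g \<in> G \<Longrightarrow> heir g < g"
  using heir_props[of g] ghosts by (cases "heir g = g") fastforce+

lemma heir_mono: "1 \<le> k \<Longrightarrow> k \<le> m \<Longrightarrow> heir k \<le> heir m"
  using heir_props[of k] heir_props(4)[of m "heir k"] by auto

lemma heir_between: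
  assumes "1 \<le> k" "k \<le> m" "heir m \<le> k"
  shows "heir k = heir m"
proof (rule antisym)
  show "heir k \<le> heir m" using assms heir_mono by blast
  show "heir m \<le> heir k" using assms heir_props[of m] heir_props(4)[of k "heir m"] by simp
qed

text \<open>A set \<open>S\<close> of live particles consists of the minima of their labels: actors that have merged are
  represented by the leftmost one. The roles still to be played have the same minima.\<close>

definition heir_closed :: "nat set \<Rightarrow> bool" where
  "heir_closed S \<longleftrightarrow> S \<subseteq> {1..n} \<and> heir ` S \<subseteq> S"

lemma heir_closedD:
  assumes "heir_closed S"
  shows "finite S" "k \<in> S \<Longrightarrow> 1 \<le> k" "k \<in> S \<Longrightarrow> k \<le> n" "k \<in> S \<Longrightarrow> heir k \<in> S"
  using assms finite_subset[of S "{1..n}"] by (auto simp: heir_closed_def)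

text \<open>Closure under \<open>heir\<close> guarantees the neighbour: \<open>heir g\<close> is
  live and lies below \<open>g\<close>, so the neighbour exists and belongs to the same
  heir.\<close>

lemma ghost_pred:
  assumes "heir_closed S" "g \<in> S \<inter> G"
  shows "pred_in S g \<in> S" "pred_in S g < g" "\<And>l. l \<in> S \<Longrightarrow> l < g \<Longrightarrow> l \<le> pred_in S g"
    "heir g \<le> pred_in S g"
  using pred_in[of "heir g" S g] heir_less[of g] heir_closedD[OF assms(1)] assms(2) by auto

text \<open>A set, so that an edge shared by several trajectories is counted once.\<close>

definition tree_edges :: "nat set \<Rightarrow> (nat \<Rightarrow> 'v list) \<Rightarrow> 'v rel" where
  "tree_edges S p = (\<Union>k\<in>S. set (path_edges (p k)))"

text \<open>Trajectories of the live particles; they coalesce because their edges form a single-valued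
  relation.\<close>

definition families :: "nat set \<Rightarrow> (nat \<Rightarrow> 'v) \<Rightarrow> (nat \<Rightarrow> 'v list) set" where
  "families S u = {p \<in> extensional S.
     (\<forall>k\<in>S. is_path V E (u k) (p k) (z (heir k))) \<and>
     single_valued (tree_edges S p) \<and>
     (\<forall>k\<in>S. \<forall>l\<in>S. set (p k) \<inter> set (p l) \<noteq> {} \<longrightarrow> heir k = heir l)}"

text \<open>The description has the form used in \<open>coalescence_vertex\<close>, so the two agree
  by unfolding.\<close>

definition least :: "'v set \<Rightarrow> 'v" where
  "least C = (THE v. v \<in> C \<and> (\<forall>t\<in>C. (v, t) \<in> leV))"

lemma least_eqI: "v \<in> C \<Longrightarrow> (\<And>t. t \<in> C \<Longrightarrow> (v, t) \<in> leV) \<Longrightarrow> least C = v"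
  unfolding least_def using leV_antisym by (intro the_equality) auto

definition ghost_factor :: "nat set \<Rightarrow> (nat \<Rightarrow> 'v list) \<Rightarrow> nat \<Rightarrow> 'a" where
  "ghost_factor S p g = path_sum V E w (least (set (p (pred_in S g)) \<inter> set (p g))) (z g)"

definition family_weight :: "nat set \<Rightarrow> (nat \<Rightarrow> 'v list) \<Rightarrow> 'a" where
  "family_weight S p = (\<Prod>e\<in>tree_edges S p. w e) * (\<Prod>g\<in>S \<inter> G. ghost_factor S p g)"

definition family_sum :: "nat set \<Rightarrow> (nat \<Rightarrow> 'v) \<Rightarrow> 'a" where
  "family_sum S u = (\<Sum>p\<in>families S u. family_weight S p)"

lemma familiesD:
  assumes "p \<in> families S u"
  shows "p \<in> extensional S" "k \<in> S \<Longrightarrow> is_path V E (u k) (p k) (z (heir k))"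
    "single_valued (tree_edges S p)"
    "k \<in> S \<Longrightarrow> l \<in> S \<Longrightarrow> v \<in> set (p k) \<Longrightarrow> v \<in> set (p l) \<Longrightarrow> heir k = heir l"
  using assms by (auto simp: families_def)

lemma familiesI:
  assumes "p \<in> extensional S" "\<And>k. k \<in> S \<Longrightarrow> is_path V E (u k) (p k) (z (heir k))"
    and "single_valued (tree_edges S p)"
    and "\<And>k l v. k \<in> S \<Longrightarrow> l \<in> S \<Longrightarrow> v \<in> set (p k) \<Longrightarrow> v \<in> set (p l) \<Longrightarrow> heir k = heir l"
  shows "p \<in> families S u"
  using assms by (auto simp: families_def)

lemma finite_families: "finite S \<Longrightarrow> finite (families S u)"
  by (rule finite_subset[of _ "PiE S (\<lambda>k. {p. is_path V E (u k) p (z (heir k))})"])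
    (auto simp: families_def finite_paths PiE_iff dest: extensional_arb intro!: finite_PiE)

lemma finite_tree_edges: "finite S \<Longrightarrow> finite (tree_edges S p)"
  by (simp add: tree_edges_def)

lemma tree_edges_remove: "k \<in> S \<Longrightarrow> tree_edges S p = set (path_edges (p k)) \<union> tree_edges (S - {k}) p"
  by (auto simp: tree_edges_def)

lemma tree_edges_upd: "tree_edges (S - {k}) (p(k := r)) = tree_edges (S - {k}) p"
  by (auto simp: tree_edges_def)

lemma tree_edges_subset: "p \<in> families S u \<Longrightarrow> tree_edges S p \<subseteq> E"
  by (auto simp: families_def tree_edges_def is_path_iff_edges)

lemma family_sum_empty: "family_sum {} u = 1"
proof -
  have "families {} u = {\<lambda>_. undefined}" by (auto simp: families_def tree_edges_def single_valued_def)
  then show ?thesis by (simp add: family_sum_def family_weight_def tree_edges_def)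
qed

lemma family_sum_no_path:
  assumes "k \<in> S" "\<And>p. \<not> is_path V E (u k) p (z (heir k))"
  shows "family_sum S u = 0"
proof -
  have "families S u = {}" using assms by (auto simp: families_def)
  then show ?thesis by (simp add: family_sum_def)
qed

text \<open>An edge leaving the root lies on a trajectory through it, hence on one with the same
  heir, which ends at that root; acyclicity forbids the return.\<close>

lemma root_no_exit:
  assumes "p \<in> families S u" "k \<in> S"
  shows "(z (heir k), v) \<notin> tree_edges S p"
proof
  assume "(z (heir k), v) \<in> tree_edges S p"
  then obtain l where l: "l \<in> S" "(z (heir k), v) \<in> set (path_edges (p l))" by (auto simp: tree_edges_def)
  then have in_l: "z (heir k) \<in> set (p l)" "v \<in> set (p l)" using set_path_edges by force+
  have "heir k = heir l"
    using familiesD(4)[OF assms l(1) _ in_l(1)] path_end_mem[OF familiesD(2)[OF assms]] by simp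
  then have "(z (heir l), v) \<in> E" using l tree_edges_subset[OF assms(1)] by (auto simp: tree_edges_def)
  then show False using path_not_back[OF familiesD(2)[OF assms(1) l(1)]] in_l by blast
qed

lemma same_start_same_path:
  assumes "p \<in> families S u" "k \<in> S" "l \<in> S" "u k = u l"
  shows "p k = p l"
proof -
  note paths = familiesD(2)[OF assms(1,2)] familiesD(2)[OF assms(1,3)]
  have eq: "heir k = heir l"
    using familiesD(4)[OF assms(1-3), of "u k"] path_start_mem[OF paths(1)] path_start_mem[OF paths(2)]
    by (simp add: assms(4))
  have "is_path V (tree_edges S p) (u k) (p k) (z (heir k))"
    "is_path V (tree_edges S p) (u k) (p l) (z (heir k))"
    using paths assms(2-4) eq by (auto simp: is_path_iff_edges tree_edges_def)
  then show ?thesis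
    using single_valued_path_unique familiesD(3)[OF assms(1)] root_no_exit[OF assms(1,2)] by metis
qed

text \<open>Trajectories from the same vertex coincide, so that of \<open>i'\<close> can be erased
  without losing an edge; what remains of it is the factor of the ghost \<open>i'\<close>, whose
  coalescence vertex is \<open>u i\<close>. A non-ghost \<open>i'\<close> is the minimum of another
  heir, and trajectories of different heirs share no vertex.\<close>

lemma family_sum_merge:
  assumes S: "heir_closed S" and i: "i \<in> S" "i' \<in> S" "i < i'" "u i = u i'"
    and adjacent: "\<And>k. k \<in> S \<Longrightarrow> k < i' \<Longrightarrow> k \<le> i"
  shows "family_sum S u = (if i' \<in> G then path_sum V E w (u i) (z i') * family_sum (S - {i'}) u else 0)"
proof (cases "i' \<in> G")
  case False
  have ne: "heir i \<noteq> heir i'"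
    using heir_props(2)[of i] heir_fixed[of i'] False i heir_closedD[OF S] by fastforce
  have "families S u = {}"
  proof (rule ccontr)
    assume "families S u \<noteq> {}"
    then obtain p where p: "p \<in> families S u" by blast
    then have "u i \<in> set (p i)" "u i \<in> set (p i')"
      using path_start_mem familiesD(2)[OF p] i by metis+
    then show False using familiesD(4)[OF p i(1,2)] ne by blast
  qed
  then show ?thesis using False by (simp add: family_sum_def)
next
  case True
  \<comment> \<open>\<open>heir i'\<close> is live and below \<open>i'\<close>, hence at most
    \<open>i\<close> by adjacency.\<close>
  have heir_eq: "heir i = heir i'"
    using heir_between[of i i'] adjacent[of "heir i'"] heir_less[OF True] i heir_closedD[OF S] by auto
  have edges: "tree_edges S (p(i' := p i)) = tree_edges (S - {i'}) p" for p
    using i tree_edges_remove[of i' S] tree_edges_remove[of i "S - {i'}" p] by (auto simp: tree_edges_upd)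
  have "family_sum S u = (\<Sum>p\<in>families (S - {i'}) u. path_sum V E w (u i) (z i') * family_weight (S - {i'}) p)"
    unfolding family_sum_def
  proof (rule sum.reindex_bij_witness[of _ "\<lambda>p. p(i' := p i)" "\<lambda>p. p(i' := undefined)"])
    fix p assume p: "p \<in> families S u"
    have pi: "p i' = p i" using same_start_same_path[OF p i(1,2,4)] by simp
    define p' where "p' = p(i' := undefined)"
    have restore: "p'(i' := p' i) = p" using pi i by (auto simp: p'_def)
    then show "(p(i' := undefined))(i' := (p(i' := undefined)) i) = p" by (simp add: p'_def)
    have edges_p: "tree_edges (S - {i'}) p' = tree_edges S p" using edges[of p'] restore by simp
    show "p(i' := undefined) \<in> families (S - {i'}) u"
      using p edges_p unfolding p'_def[symmetric]
      by (auto simp: families_def p'_def extensional_def)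
    have SG: "S \<inter> G = insert i' ((S - {i'}) \<inter> G)" using i True by auto
    have "ghost_factor S p i' = path_sum V E w (u i) (z i')"
    proof -
      have "pred_in S i' = i" using i adjacent by (intro pred_in_eqI) auto
      moreover have "least (set (p i)) = u i"
        using familiesD(2)[OF p i(1)] by (intro least_eqI) (auto intro: path_start_mem path_le)
      ultimately show ?thesis by (simp add: ghost_factor_def pi)
    qed
    moreover have "ghost_factor S p g = ghost_factor (S - {i'}) p' g" if g: "g \<in> (S - {i'}) \<inter> G" for g
    proof -
      note pg = ghost_pred[OF S, of g]
      \<comment> \<open>A ghost whose left neighbour was \<open>i'\<close> now has \<open>i\<close>
        there. The two had equal trajectories, so the coalescence vertex stays.\<close>
      have "p (pred_in S g) = p' (pred_in (S - {i'}) g)"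
      proof (cases "pred_in S g = i'")
        case True
        have "pred_in (S - {i'}) g = i"
          using i True pg g adjacent by (intro pred_in_eqI) (auto simp: le_less)
        then show ?thesis using True pi i by (simp add: p'_def)
      next
        case False
        have "pred_in (S - {i'}) g = pred_in S g"
          using False pg g by (intro pred_in_eqI) auto
        then show ?thesis using False by (simp add: p'_def)
      qed
      then show ?thesis using g by (simp add: ghost_factor_def p'_def)
    qed
    ultimately show "path_sum V E w (u i) (z i') * family_weight (S - {i'}) (p(i' := undefined)) = family_weight S p"
      unfolding p'_def[symmetric] family_weight_def edges_p SG
      using heir_closedD(1)[OF S] by simp
  next
    fix p assume p: "p \<in> families (S - {i'}) u"
    show "(p(i' := p i))(i' := undefined) = p"
      using familiesD(1)[OF p] by (auto simp: extensional_def)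
    have "is_path V E (u i') (p i) (z (heir i'))" using familiesD(2)[OF p, of i] i heir_eq by simp
    then show "p(i' := p i) \<in> families S u"
    proof (intro familiesI)
      show "single_valued (tree_edges S (p(i' := p i)))" using familiesD(3)[OF p] edges by simp
      show "heir k = heir l"
        if "k \<in> S" "l \<in> S" "v \<in> set ((p(i' := p i)) k)" "v \<in> set ((p(i' := p i)) l)" for k l v
        using familiesD(4)[OF p, of "if k = i' then i else k" "if l = i' then i else l" v] that i heir_eq
        by (auto split: if_splits)
    qed (use familiesD(1,2)[OF p] i in \<open>auto simp: extensional_def\<close>)
  qed
  then show ?thesis using True by (simp add: family_sum_def sum_distrib_left)
qed

section \<open>Families whose lowest particle is alone\<close>

definition lone_lowest :: "nat set \<Rightarrow> (nat \<Rightarrow> 'v) \<Rightarrow> nat \<Rightarrow> bool" where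
  "lone_lowest S u i \<longleftrightarrow> i \<in> S \<and> (\<forall>l\<in>S. (u i, u l) \<in> leV \<and> (l \<noteq> i \<longrightarrow> u i \<noteq> u l))"

lemma lone_lowest_avoids:
  assumes "lone_lowest S u i" "l \<in> S" "l \<noteq> i" "is_path V E (u l) p b"
  shows "u i \<notin> set p"
proof
  assume "u i \<in> set p"
  then have "(u l, u i) \<in> leV" using assms(4) path_le by blast
  then show False using assms(1-3) leV_antisym by (auto simp: lone_lowest_def)
qed

text \<open>A family in which \<open>i\<close> moves arises by prepending \<open>u i\<close> to a
  family that starts one step later. No trajectory of the latter passes through \<open>u i\<close>,
  so exactly one edge is new, the edges stay single-valued and every coalescence vertex is
  kept.\<close>

lemma family_sum_advance:
  assumes S: "heir_closed S" and low: "lone_lowest S u i" and "u i \<in> V"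
    and N: "finite N" "\<And>t. t \<in> N \<Longrightarrow> (u i, t) \<in> E"
      "\<And>t p. (u i, t) \<in> E \<Longrightarrow> is_path V E t p (z (heir i)) \<Longrightarrow> t \<in> N"
  shows "family_sum S u = (\<Sum>p | p \<in> families S u \<and> p i = [u i]. family_weight S p) +
    (\<Sum>t\<in>N. w (u i, t) * family_sum S (u(i := t)))"
proof -
  have i: "i \<in> S" using low by (simp add: lone_lowest_def)
  define ext where "ext p = p(i := u i # p i)" for p :: "nat \<Rightarrow> 'v list"
  have avoid: "u i \<notin> set (p l)" if "t \<in> N" "p \<in> families S (u(i := t))" "l \<in> S" for t p l
  proof (cases "l = i")
    case True
    then have "is_path V E t (p i) (z (heir i))" using familiesD(2)[OF that(2) i] by simp
    then show ?thesis
      using True N(2)[OF that(1)] path_le(1) edge_less leV_antisym by metis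
  next
    case False
    then show ?thesis using lone_lowest_avoids[OF low that(3)] familiesD(2)[OF that(2,3)] by simp
  qed
  have start: "p i \<noteq> [] \<and> hd (p i) = t" if "p \<in> families S (u(i := t))" for p t
    using familiesD(2)[OF that i] by (simp add: is_path_def)
  have ext_edges: "tree_edges S (ext p) = insert (u i, t) (tree_edges S p)"
    if "p \<in> families S (u(i := t))" for p t
  proof -
    show ?thesis
      unfolding tree_edges_remove[OF i] using start[OF that]
      by (auto simp: tree_edges_upd ext_def path_edges_Cons)
  qed
  have fresh: "(u i, b) \<notin> tree_edges S p" if "t \<in> N" "p \<in> families S (u(i := t))" for t p b
    using avoid[OF that] set_path_edges by (fastforce simp: tree_edges_def)
  have ext_in: "ext p \<in> families S u" if t: "t \<in> N" and p: "p \<in> families S (u(i := t))" for t p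
  proof -
    have "is_path V E (u i) (ext p i) (z (heir i))"
      using familiesD(2)[OF p i] N(2)[OF t] \<open>u i \<in> V\<close> by (auto simp: ext_def intro: is_path_ConsI)
    moreover have "is_path V E (u k) (ext p k) (z (heir k))" if "k \<in> S" "k \<noteq> i" for k
      using familiesD(2)[OF p] that by (force simp: ext_def)
    moreover have "single_valued (tree_edges S (ext p))"
      using familiesD(3)[OF p] fresh[OF t p] unfolding ext_edges[OF p] by (auto simp: single_valued_def)
    moreover have "ext p \<in> extensional S"
      using familiesD(1)[OF p] i by (auto simp: ext_def extensional_def)
    moreover have "heir k = heir l" if "k \<in> S" "l \<in> S" "v \<in> set (ext p k)" "v \<in> set (ext p l)" for k l v
    proof (cases "k = l")
      case False
      then have "v \<noteq> u i" using avoid[OF t p] that by (auto simp: ext_def split: if_splits)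
      then show ?thesis using familiesD(4)[OF p that(1,2)] that by (auto simp: ext_def split: if_splits)
    qed simp
    ultimately show ?thesis by (auto simp: families_def)
  qed
  have ext_weight: "family_weight S (ext p) = w (u i, t) * family_weight S p"
    if t: "t \<in> N" and p: "p \<in> families S (u(i := t))" for t p
  proof -
    have "ghost_factor S (ext p) g = ghost_factor S p g" if g: "g \<in> S \<inter> G" for g
    proof -
      have "set (ext p (pred_in S g)) \<inter> set (ext p g) = set (p (pred_in S g)) \<inter> set (p g)"
        using ghost_pred[OF S g] avoid[OF t p] g by (auto simp: ext_def)
      then show ?thesis by (simp add: ghost_factor_def)
    qed
    moreover have "(\<Prod>e\<in>tree_edges S (ext p). w e) = w (u i, t) * (\<Prod>e\<in>tree_edges S p. w e)"
      using finite_tree_edges[OF heir_closedD(1)[OF S]] fresh[OF t p] unfolding ext_edges[OF p] by simp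
    ultimately show ?thesis by (simp add: family_weight_def mult_ac)
  qed
  have inj: "inj_on ext A" for A
    by (rule inj_onI) (metis (no_types, lifting) ext_def fun_upd_same fun_upd_triv fun_upd_upd list.inject)
  have split: "families S u = {p \<in> families S u. p i = [u i]} \<union> (\<Union>t\<in>N. ext ` families S (u(i := t)))"
  proof (intro subset_antisym subsetI)
    fix p assume p: "p \<in> families S u"
    note path = familiesD(2)[OF p i]
    obtain r where r: "p i = u i # r" using path by (cases "p i") (auto simp: is_path_def)
    show "p \<in> {p \<in> families S u. p i = [u i]} \<union> (\<Union>t\<in>N. ext ` families S (u(i := t)))"
    proof (cases "r = []")
      case True
      then show ?thesis using p r by simp
    next
      case False
      define p' where "p' = p(i := r)"
      have p': "p = ext p'" using r by (auto simp: p'_def ext_def)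
      have path': "is_path V E (hd r) r (z (heir i))" "(u i, hd r) \<in> E"
        using path r False by (auto simp: is_path_Cons)
      have sub: "tree_edges S p' \<subseteq> tree_edges S p"
        unfolding tree_edges_remove[OF i] using r by (auto simp: tree_edges_upd p'_def path_edges_Cons)
      have shorter: "set (p' k) \<subseteq> set (p k)" for k using r by (auto simp: p'_def)
      have "p' \<in> families S (u(i := hd r))"
      proof (rule familiesI)
        show "heir k = heir l" if "k \<in> S" "l \<in> S" "v \<in> set (p' k)" "v \<in> set (p' l)" for k l v
          using familiesD(4)[OF p that(1,2)] that(3,4) shorter by blast
        show "single_valued (tree_edges S p')" using familiesD(3)[OF p] single_valued_subset[OF sub] by blast
      qed (use familiesD(1,2)[OF p] path' i in \<open>auto simp: p'_def extensional_def\<close>)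
      then show ?thesis using N(3)[OF path'(2,1)] p' by blast
    qed
  qed (use ext_in in auto)
  have fin: "finite (families S u')" for u' using finite_families heir_closedD(1)[OF S] by blast
  \<comment> \<open>The second vertex of the extended trajectory recovers the first step, so
    different steps yield disjoint sets of families.\<close>
  have hd: "ext p i \<noteq> [u i] \<and> hd (tl (ext p i)) = t" if "p \<in> families S (u(i := t))" for p t
    using start[OF that] by (simp add: ext_def)
  have disj: "ext ` families S (u(i := t)) \<inter> ext ` families S (u(i := t')) = {}" if "t \<noteq> t'" for t t'
  proof (rule ccontr)
    assume "\<not> ?thesis"
    then obtain p p' where "p \<in> families S (u(i := t))" "p' \<in> families S (u(i := t'))" "ext p = ext p'"
      by blast
    then show False using hd[of p t] hd[of p' t'] that by simp
  qed
  have "family_sum S u = (\<Sum>p | p \<in> families S u \<and> p i = [u i]. family_weight S p) +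
      (\<Sum>p\<in>(\<Union>t\<in>N. ext ` families S (u(i := t))). family_weight S p)"
    unfolding family_sum_def by (subst split, rule sum.union_disjoint) (use fin N(1) hd in auto)
  also have "(\<Sum>p\<in>(\<Union>t\<in>N. ext ` families S (u(i := t))). family_weight S p) =
      (\<Sum>t\<in>N. \<Sum>p\<in>ext ` families S (u(i := t)). family_weight S p)"
    using fin N(1) disj by (intro sum.UNION_disjoint) auto
  also have "\<dots> = (\<Sum>t\<in>N. w (u i, t) * family_sum S (u(i := t)))"
    by (rule sum.cong[OF refl], subst sum.reindex[OF inj])
      (auto simp: family_sum_def sum_distrib_left ext_weight intro!: sum.cong)
  finally show ?thesis .
qed

text \<open>Stopping at once means standing at the root. Any other live particle with that heir
  would have to end at \<open>u i\<close>, which its path avoids. So \<open>i\<close> is alone in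
  its heir, and it equals \<open>heir i\<close>, since that index is live.\<close>

lemma family_sum_stop:
  assumes S: "heir_closed S" and low: "lone_lowest S u i" and "u i \<in> V"
  shows "(\<Sum>p | p \<in> families S u \<and> p i = [u i]. family_weight S p) =
    (if u i = z i \<and> i \<notin> G \<and> (\<forall>s\<in>S - {i}. heir s \<noteq> i) then family_sum (S - {i}) u else 0)"
proof -
  have i: "i \<in> S" using low by (simp add: lone_lowest_def)
  then have i1: "1 \<le> i" using heir_closedD[OF S] by blast
  have no: "heir s \<noteq> heir i" if p: "p \<in> families S u" "p i = [u i]" and s: "s \<in> S - {i}" for p s
  proof
    assume eq: "heir s = heir i"
    have "u i = z (heir i)" using familiesD(2)[OF p(1) i] p(2) by (simp add: is_path_def)
    then have "u i \<in> set (p s)" using path_end_mem[OF familiesD(2)[OF p(1), of s]] s eq by auto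
    then show False using lone_lowest_avoids[OF low] s familiesD(2)[OF p(1)] by blast
  qed
  show ?thesis
  proof (cases "u i = z i \<and> i \<notin> G \<and> (\<forall>s\<in>S - {i}. heir s \<noteq> i)")
    case False
    have "\<not> (p \<in> families S u \<and> p i = [u i])" for p
    proof
      assume p: "p \<in> families S u \<and> p i = [u i]"
      then have z: "u i = z (heir i)" using familiesD(2)[OF _ i, of p u] by (simp add: is_path_def)
      have "heir (heir i) = heir i" using heir_fixed heir_props[OF i1] by blast
      then have "heir i = i" using no[of p "heir i"] p heir_closedD(4)[OF S i] by blast
      then show False using False no p z heir_props[OF i1] by auto
    qed
    then have "{p. p \<in> families S u \<and> p i = [u i]} = {}" by blast
    then show ?thesis using False by (auto simp only: sum.empty if_False)
  next
    case True
    have hi: "heir i = i" using heir_fixed i1 True by blast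
    have "(\<Sum>p | p \<in> families S u \<and> p i = [u i]. family_weight S p) = family_sum (S - {i}) u"
      unfolding family_sum_def
    proof (rule sum.reindex_bij_witness[of _ "\<lambda>p. p(i := [u i])" "\<lambda>p. p(i := undefined)"])
      fix p assume "p \<in> {p. p \<in> families S u \<and> p i = [u i]}"
      then have p: "p \<in> families S u" "p i = [u i]" by auto
      define p' where "p' = p(i := undefined)"
      show "(p(i := undefined))(i := [u i]) = p" using p(2) by auto
      have edges: "tree_edges (S - {i}) p' = tree_edges S p"
        using p(2) by (simp add: tree_edges_remove[OF i] tree_edges_upd p'_def path_edges_Cons)
      show "p(i := undefined) \<in> families (S - {i}) u"
        using p edges unfolding p'_def[symmetric] by (auto simp: families_def p'_def extensional_def)
      have "ghost_factor S p g = ghost_factor (S - {i}) p' g" if g: "g \<in> S \<inter> G" for g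
      proof -
        note pg = ghost_pred[OF S g]
        \<comment> \<open>A ghost with left neighbour \<open>i\<close> would belong to the heir
          \<open>i\<close>, where \<open>i\<close> is the only live particle.\<close>
        have "pred_in S g \<noteq> i"
        proof
          assume "pred_in S g = i"
          then have "heir g = i" using pg heir_between[OF i1, of g] hi by auto
          then show False using True g by auto
        qed
        moreover from this have "pred_in (S - {i}) g = pred_in S g" using pg by (intro pred_in_eqI) auto
        ultimately show ?thesis using g True by (auto simp: ghost_factor_def p'_def)
      qed
      moreover have "(S - {i}) \<inter> G = S \<inter> G" using True by auto
      ultimately show "family_weight (S - {i}) (p(i := undefined)) = family_weight S p"
        unfolding p'_def[symmetric] family_weight_def edges by simp
    next
      fix p assume p: "p \<in> families (S - {i}) u"
      show "(p(i := [u i]))(i := undefined) = p"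
        using familiesD(1)[OF p] by (auto simp: extensional_def)
      have "u i \<notin> set (p l)" if "l \<in> S - {i}" for l
        using lone_lowest_avoids[OF low] that familiesD(2)[OF p that] by blast
      moreover have "tree_edges S (p(i := [u i])) = tree_edges (S - {i}) p"
        by (simp add: tree_edges_remove[OF i] tree_edges_upd path_edges_Cons)
      moreover have "is_path V E (u i) [u i] (z (heir i))"
        using True hi closed_path \<open>u i \<in> V\<close> by metis
      ultimately show "p(i := [u i]) \<in> {p. p \<in> families S u \<and> p i = [u i]}"
        using p i by (auto simp: families_def extensional_def)
    qed
    then show ?thesis using True by simp
  qed
qed

end

section \<open>The recursion for the determinant\<close>

context casting begin

text \<open>The signed Iverson bracket of the matrix: \<open>k < m\<close> is
  \<open>k + 1 \<le> m\<close>, which says that actor \<open>k\<close> precedes the junction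
  \<open>m\<close>. For a merged particle, \<open>k\<close> is its leftmost actor.\<close>

definition coeff :: "nat \<Rightarrow> nat \<Rightarrow> 'a" where
  "coeff k m = (if m \<notin> G then 1 else if k < m then - of_bool (\<epsilon> m = -1) else of_bool (\<epsilon> m = 1))"

definition entry :: "(nat \<Rightarrow> 'v) \<Rightarrow> nat \<Rightarrow> nat \<Rightarrow> 'a" where
  "entry u k m = coeff k m * path_sum V E w (u k) (z m)"

lemma path_sum_nonzero: "path_sum V E w a b \<noteq> 0 \<Longrightarrow> \<exists>p. is_path V E a p b"
  by (metis (no_types, lifting) empty_Collect_eq path_sum_def sum.empty)

text \<open>Rows \<open>i\<close> and \<open>i'\<close> differ only in the column of the ghost \<open>i'\<close>, by exactly one of the two
  Iverson brackets.\<close>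

lemma set_det_merge:
  assumes S: "heir_closed S" and i: "i \<in> S" "i' \<in> S" "i < i'" "u i = u i'"
    and adjacent: "\<And>k. k \<in> S \<Longrightarrow> k < i' \<Longrightarrow> k \<le> i"
  shows "set_det (entry u) S =
    (if i' \<in> G then path_sum V E w (u i) (z i') * set_det (entry u) (S - {i'}) else 0)"
proof -
  note fin = heir_closedD(1)[OF S]
  \<comment> \<open>No live index lies strictly between \<open>i\<close> and \<open>i'\<close>, so
    each junction other than \<open>i'\<close> is on the same side of both.\<close>
  have same: "entry u i' m = entry u i m" if "m \<in> S" "m \<noteq> i' \<or> m \<notin> G" for m
    using that i adjacent[of m] by (fastforce simp: entry_def coeff_def)
  show ?thesis
  proof (cases "i' \<in> G")
    case False
    have "entry u i m = entry u i' m" if "m \<in> S" for m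
      using same[of m] that False by (cases "m = i'") auto
    then have "set_det (entry u) S = 0"
      using i fin by (intro set_det_equal_rows[of S i i']) auto
    then show ?thesis using False by simp
  next
    case True
    define W where "W = path_sum V E w (u i) (z i')"
    have "\<epsilon> i' = 1 \<or> \<epsilon> i' = -1" using signs[OF True] by auto
    then have diff: "entry u i' i' = entry u i i' + W"
      using True i by (auto simp: entry_def coeff_def W_def)
    \<comment> \<open>The one-element index set \<open>{()}\<close> brings the sum of two rows into
      the form of \<open>set_det_row_linear\<close>.\<close>
    have "set_det (entry u) S =
        set_det ((entry u)(i' := \<lambda>m. entry u i m + (\<Sum>t\<in>{()}. 1 * (of_bool (m = i') * W)))) S"
      using same diff by (intro set_det_cong) auto
    also have "\<dots> = set_det ((entry u)(i' := entry u i)) S +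
        set_det ((entry u)(i' := \<lambda>m. of_bool (m = i') * W)) S"
      using set_det_row_linear[OF fin i(2), where A = "entry u" and f = "entry u i" and N = "{()}"
          and c = "\<lambda>_. 1" and B = "\<lambda>_ m. of_bool (m = i') * W"]
      by simp
    also have "set_det ((entry u)(i' := entry u i)) S = 0"
      using i fin by (intro set_det_equal_rows[of S i i']) auto
    also have "set_det ((entry u)(i' := \<lambda>m. of_bool (m = i') * W)) S =
        W * set_det ((entry u)(i' := \<lambda>m. of_bool (m = i') * W)) (S - {i'})"
    proof (subst set_det_expand_diagonal[OF fin i(2)])
      fix \<pi> assume "\<pi> permutes S" "\<pi> i' \<noteq> i'"
      then show "(\<Prod>k\<in>S. ((entry u)(i' := \<lambda>m. of_bool (m = i') * W)) k (\<pi> k)) = 0"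
        using i fin by (intro prod_zero) (auto intro!: bexI[of _ i'])
    qed simp
    also have "set_det ((entry u)(i' := \<lambda>m. of_bool (m = i') * W)) (S - {i'}) = set_det (entry u) (S - {i'})"
      by (intro set_det_cong) auto
    finally show ?thesis using True by (simp add: W_def)
  qed
qed

text \<open>The step leaves the index \<open>i\<close>, hence every coefficient of its row,
  unchanged. In contrast to families, where \<open>i\<close> only heads for its own heir,
  \<open>N\<close> has to serve the targets of all roles in \<open>S\<close>.\<close>

lemma set_det_advance:
  assumes S: "heir_closed S" and i: "i \<in> S" "u i \<in> V"
    and N: "finite N" "\<And>t. t \<in> N \<Longrightarrow> (u i, t) \<in> E"
      "\<And>t p m. (u i, t) \<in> E \<Longrightarrow> m \<in> S \<Longrightarrow> is_path V E t p (z m) \<Longrightarrow> t \<in> N"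
  shows "set_det (entry u) S = set_det ((entry u)(i := \<lambda>m. coeff i m * of_bool (u i = z m))) S +
    (\<Sum>t\<in>N. w (u i, t) * set_det (entry (u(i := t))) S)"
proof -
  note fin = heir_closedD(1)[OF S]
  define B where "B = (\<lambda>t m. coeff i m * path_sum V E w t (z m))"
  have row: "entry u i m = coeff i m * of_bool (u i = z m) + (\<Sum>t\<in>N. w (u i, t) * B t m)" if "m \<in> S" for m
  proof -
    have "path_sum V E w (u i) (z m) =
        of_bool (u i = z m) + (\<Sum>t\<in>N. w (u i, t) * path_sum V E w t (z m))"
      by (rule path_sum_by_first_step[OF i(2) N(1,2)]) (use N(3) that in blast)+
    then show ?thesis by (simp add: entry_def B_def distrib_left sum_distrib_left mult_ac)
  qed
  have "set_det (entry u) S =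
      set_det ((entry u)(i := \<lambda>m. coeff i m * of_bool (u i = z m) + (\<Sum>t\<in>N. w (u i, t) * B t m))) S"
    using row by (intro set_det_cong) auto
  also have "\<dots> = set_det ((entry u)(i := \<lambda>m. coeff i m * of_bool (u i = z m))) S +
      (\<Sum>t\<in>N. w (u i, t) * set_det ((entry u)(i := B t)) S)"
    by (rule set_det_row_linear[OF fin i(1)])
  also have "(\<Sum>t\<in>N. w (u i, t) * set_det ((entry u)(i := B t)) S) =
      (\<Sum>t\<in>N. w (u i, t) * set_det (entry (u(i := t))) S)"
    by (intro sum.cong refl arg_cong[where f = "(*) _"] set_det_cong) (auto simp: B_def entry_def)
  finally show ?thesis .
qed

section \<open>Planarity and particles in mid-course\<close>

lemma crossing:
  assumes "k \<in> {1..n}" "l \<in> {1..n}" "k \<le> l" "m \<in> {1..n}" "m' \<in> {1..n}" "(z m', z m) \<in> rY"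
    and "is_path V E (x k) A (z m)" "is_path V E (x l) B (z m')"
  shows "set A \<inter> set B \<noteq> {}"
proof -
  have "x k \<in> X" "x l \<in> X" "(x k, x l) \<in> rX" using initial assms(1-3) by (auto simp: initial_state_def)
  then show ?thesis using planar assms(4-8) targets unfolding planar_pair_def by meson
qed

lemma nested_crossing:
  assumes "j \<in> {1..n}" "k \<in> {1..n}" "l \<in> {1..n}" "j \<le> k" "k \<le> l"
    and "a \<in> {1..n}" "b \<in> {1..n}" "c \<in> {1..n}"
    and "is_path V E (x j) A (z a)" "is_path V E (x k) B (z b)" "is_path V E (x l) C (z c)"
    and "v \<in> set A" "v \<in> set C"
  shows "\<exists>t. (t, v) \<in> leV \<and> t \<in> set B \<inter> (set A \<union> set C)"
proof -
  have "x j \<in> X" "x k \<in> X" "x l \<in> X" "(x j, x k) \<in> rX" "(x k, x l) \<in> rX"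
    using initial assms(1-5) by (auto simp: initial_state_def)
  moreover have "v \<in> set A \<inter> set C" using assms by simp
  ultimately show ?thesis using planar assms(6-11) targets unfolding planar_pair_def by meson
qed

lemma target_order: "linear_order_on Y rY"
  using planar by (simp add: planar_pair_def)

lemma target_trans: "(a, b) \<in> rY \<Longrightarrow> (b, c) \<in> rY \<Longrightarrow> (a, c) \<in> rY"
  using target_order by (auto simp: order_on_defs dest: transD)

lemma target_refl: "m \<in> {1..n} \<Longrightarrow> (z m, z m) \<in> rY"
  using target_order targets by (auto simp: order_on_defs refl_on_def)

text \<open>\<open>q k\<close> lists the vertices that particle \<open>k\<close> has left behind. They precede all current
  positions because the lowest particle is always the one to move.\<close>

definition history :: "nat set \<Rightarrow> (nat \<Rightarrow> 'v) \<Rightarrow> (nat \<Rightarrow> 'v list) \<Rightarrow> bool" where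
  "history S u q \<longleftrightarrow>
     (\<forall>k\<in>S. is_path V E (x k) (q k @ [u k]) (u k)) \<and>
     (\<forall>k\<in>S. \<forall>l\<in>S. \<forall>v\<in>set (q k). (v, u l) \<in> leV \<and> v \<noteq> u l) \<and>
     (\<forall>k\<in>S. \<forall>l\<in>S. k \<noteq> l \<longrightarrow> set (q k) \<inter> set (q l) = {})"

lemma historyD:
  assumes "history S u q"
  shows "k \<in> S \<Longrightarrow> is_path V E (x k) (q k @ [u k]) (u k)"
    "k \<in> S \<Longrightarrow> l \<in> S \<Longrightarrow> v \<in> set (q k) \<Longrightarrow> (v, u l) \<in> leV"
    "k \<in> S \<Longrightarrow> l \<in> S \<Longrightarrow> v \<in> set (q k) \<Longrightarrow> v \<noteq> u l"
    "k \<in> S \<Longrightarrow> l \<in> S \<Longrightarrow> k \<noteq> l \<Longrightarrow> v \<in> set (q k) \<Longrightarrow> v \<notin> set (q l)"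
  using assms unfolding history_def by blast+

lemma history_subset: "history S u q \<Longrightarrow> S' \<subseteq> S \<Longrightarrow> history S' u q"
  unfolding history_def by (meson subsetD)

lemma history_position: "history S u q \<Longrightarrow> k \<in> S \<Longrightarrow> u k \<in> V"
  using historyD(1) path_in(2) by blast

text \<open>This turns a path from a current position into one from \<open>X\<close>, to which (P1)
  and (P2) apply.\<close>

lemma history_extend:
  assumes "history S u q" "k \<in> S" "is_path V E (u k) p b"
  shows "is_path V E (x k) (q k @ p) b"
  using is_path_append[OF historyD(1)[OF assms(1,2)] assms(3)] .

text \<open>\<open>leV\<close> increases along paths, while past vertices lie strictly below all
  positions, those of other particles included.\<close>

lemma past_avoids_future:
  assumes "history S u q" "k \<in> S" "l \<in> S" "v \<in> set (q k)" "is_path V E (u l) p b"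
  shows "v \<notin> set p"
  using path_le(1)[OF assms(5)] historyD(2,3)[OF assms(1-4)] leV_antisym by blast

text \<open>The vertex left by \<open>i\<close> joins its past. It is strictly below all other
  positions because \<open>i\<close> is alone and lowest, and it is in no other past because pasts
  avoid all old positions.\<close>

lemma history_advance:
  assumes H: "history S u q" and low: "lone_lowest S u i" and t: "(u i, t) \<in> E"
  shows "history S (u(i := t)) (q(i := q i @ [u i]))"
proof -
  have i: "i \<in> S" and low': "\<And>l. l \<in> S \<Longrightarrow> (u i, u l) \<in> leV" "\<And>l. l \<in> S \<Longrightarrow> l \<noteq> i \<Longrightarrow> u i \<noteq> u l"
    using low by (auto simp: lone_lowest_def)
  have tV: "t \<in> V" "u i \<in> V" using t edges_in by auto
  note ut = edge_less[OF t]
  have "is_path V E (u i) ([u i] @ [t]) t" using t tV by (simp add: is_path_Cons)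
  then have "is_path V E (x i) (q i @ [u i] @ [t]) t" by (rule history_extend[OF H i])
  moreover have "(v, (u(i := t)) l) \<in> leV \<and> v \<noteq> (u(i := t)) l"
    if "k \<in> S" "l \<in> S" "v \<in> set ((q(i := q i @ [u i])) k)" for k l v
  proof -
    have "(v, u i) \<in> leV \<and> (v, u l) \<in> leV \<and> (v \<noteq> u i \<or> k = i) \<and> (v = u l \<longrightarrow> l = i)"
      using that historyD(2,3)[OF H that(1) i, of v] historyD(2,3)[OF H that(1,2), of v] low'
      by (auto simp: leV_refl[OF tV(2)] split: if_splits)
    then show ?thesis using ut leV_trans[of v "u i" t] leV_antisym[of v "u i"] by auto
  qed
  moreover have "set ((q(i := q i @ [u i])) k) \<inter> set ((q(i := q i @ [u i])) l) = {}"
    if "k \<in> S" "l \<in> S" "k \<noteq> l" for k l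
    using that historyD(4)[OF H that] historyD(3)[OF H _ i, of _ "u i"] by (auto split: if_splits)
  ultimately show ?thesis
    using historyD(1)[OF H] by (auto simp: history_def)
qed

text \<open>Positions ahead of the lowest particle never meet it, so by (P1) no other particle can pass the
  target at which it stops.\<close>

lemma stopped_separates:
  assumes S: "heir_closed S" and H: "history S u q" and low: "lone_lowest S u i"
    and f: "f \<in> {1..n}" "u i = z f" and k: "k \<in> S" "k \<noteq> i" and m: "m \<in> {1..n}"
    and p: "is_path V E (u k) p (z m)"
  shows "k < i \<Longrightarrow> (z f, z m) \<notin> rY" "i < k \<Longrightarrow> (z m, z f) \<notin> rY"
proof -
  have i: "i \<in> S" using low by (simp add: lone_lowest_def)
  have range: "i \<in> {1..n}" "k \<in> {1..n}" using S i k by (auto simp: heir_closed_def)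
  have A: "is_path V E (x i) (q i @ [u i]) (z f)" using historyD(1)[OF H i] f by simp
  have B: "is_path V E (x k) (q k @ p) (z m)" by (rule history_extend[OF H k(1) p])
  have "v \<notin> set (q i)" if "v \<in> set (q k @ p)" for v
    using that historyD(4)[OF H i k(1), of v] past_avoids_future[OF H i k(1) _ p, of v] k(2) by auto
  moreover have "u i \<notin> set (q k @ p)"
    using historyD(3)[OF H k(1) i, of "u i"] lone_lowest_avoids[OF low k p] by auto
  ultimately have disjoint: "set (q i @ [u i]) \<inter> set (q k @ p) = {}" by auto
  show "(z f, z m) \<notin> rY" if "k < i"
    using crossing[OF range(2,1) _ m f(1) _ B A] that disjoint by auto
  show "(z m, z f) \<notin> rY" if "i < k"
    using crossing[OF range _ f(1) m _ A B] that disjoint by auto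
qed

text \<open>If the lowest particle stopped at a role other than its own heir, then, by the signs of the ghosts,
  the particles on one side of it would have to share too few roles.\<close>

lemma stopping_casting:
  assumes S: "heir_closed S" and H: "history S u q" and low: "lone_lowest S u i"
    and \<pi>: "\<pi> permutes S" and stop: "u i = z (\<pi> i)"
    and coeff: "\<And>k. k \<in> S \<Longrightarrow> coeff k (\<pi> k) \<noteq> 0"
    and path: "\<And>k. k \<in> S - {i} \<Longrightarrow> \<exists>p. is_path V E (u k) p (z (\<pi> k))"
  shows "\<pi> i = i \<and> i \<notin> G \<and> (\<forall>s\<in>S - {i}. heir s \<noteq> i)"
proof -
  note fin = heir_closedD(1)[OF S]
  have i: "i \<in> S" using low by (simp add: lone_lowest_def)
  define f where "f = \<pi> i"
  define h where "h = heir f"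
  have range: "k \<in> {1..n}" if "k \<in> S" for k using S that by (auto simp: heir_closed_def)
  have \<pi>S: "\<pi> k \<in> S" if "k \<in> S" for k using \<pi> that by (simp add: permutes_in_image)
  have fS: "f \<in> S" using \<pi>S i by (simp add: f_def)
  have hS: "h \<in> S" using heir_closedD(4)[OF S fS] by (simp add: h_def)
  have hG: "h \<notin> G" "h \<le> f" using heir_props[of f] range[OF fS] by (auto simp: h_def)
  have heir_range: "heir m \<in> {1..n} - G" if "m \<in> S" for m
    using heir_closedD(4)[OF S that] range heir_props(3)[of m] that by force
  have stays: "k < i \<Longrightarrow> (z f, z (\<pi> k)) \<notin> rY" "i < k \<Longrightarrow> (z (\<pi> k), z f) \<notin> rY" if k: "k \<in> S" for k
    using stopped_separates[OF S H low range[OF fS] _ k _ range[OF \<pi>S[OF k]]] path[of k] k stop f_def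
    by blast+
  \<comment> \<open>Particles left of \<open>i\<close> can take neither a role with index at least
    \<open>i\<close> nor, by separation, the role \<open>h\<close>; yet \<open>h\<close> is the
    index of one of them.\<close>
  have left: False if a: "h < i" "(z f, z h) \<in> rY"
  proof (rule permutes_not_shrinking[OF \<pi> fin, of "{k \<in> S. k < i}" h])
    fix k assume "k \<in> {k \<in> S. k < i}"
    then have k: "k \<in> S" "k < i" by auto
    define m where "m = \<pi> k"
    have m: "m \<in> S" using \<pi>S k m_def by simp
    have far: "(z f, z m) \<notin> rY" using stays(1)[OF k] by (simp add: m_def)
    \<comment> \<open>A role \<open>m\<close> at or beyond \<open>i\<close> has its heir at or
      beyond \<open>h\<close>, so that heir is positioned at or after \<open>z f\<close>. If
      \<open>m\<close> were an heir or a ghost of sign -1, this would contradict \<open>far\<close>;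
      a ghost of sign +1 has coefficient 0 for \<open>k < m\<close>.\<close>
    have "m < i"
    proof (rule ccontr)
      assume "\<not> m < i"
      then have "h \<le> heir m" using heir_props(4)[of m h] a hG range[OF m] range[OF hS] by auto
      then have "(z h, z (heir m)) \<in> rY"
        using heirs_ordered heir_range[OF m] range[OF hS] hG by blast
      then have *: "(z f, z (heir m)) \<in> rY" using a(2) target_trans by blast
      have "m \<in> G" using heir_fixed[of m] * far range[OF m] by (cases "m \<in> G") auto
      then have "\<epsilon> m = 1" using signs[of m] * far target_trans by blast
      then show False using coeff[OF k(1)] \<open>\<not> m < i\<close> k(2) \<open>m \<in> G\<close> by (auto simp: m_def coeff_def)
    qed
    then show "\<pi> k \<in> {k \<in> S. k < i} - {h}" using m far a(2) by (auto simp: m_def)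
  qed (use a hS in auto)
  \<comment> \<open>Here the role that nobody can take is \<open>r\<close>, the index of the
    leftmost particle right of \<open>i\<close>. Every role up to \<open>r\<close> has its heir
    positioned at or before \<open>z f\<close>, so separation leaves only ghosts of sign -1, whose
    coefficient is 0 for particles at or beyond their junction.\<close>
  have right: False if a: "s \<in> S" "i < s" "heir s \<le> h" "(z h, z f) \<in> rY" for s
  proof -
    define R where "R = {k \<in> S. i < k}"
    define r where "r = Min R"
    have R: "finite R" "s \<in> R" using fin a by (auto simp: R_def)
    then have r: "r \<in> R" "\<And>k. k \<in> R \<Longrightarrow> r \<le> k" unfolding r_def by (auto intro: Min_in)
    have "heir r \<le> h" using heir_mono[of r s] r R(2) a(3) range by (force simp: R_def)
    show False
    proof (rule permutes_not_shrinking[OF \<pi> fin, of R r])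
      fix k assume kR: "k \<in> R"
      then have k: "k \<in> S" "i < k" by (auto simp: R_def)
      define m where "m = \<pi> k"
      have m: "m \<in> S" using \<pi>S k m_def by simp
      have far: "(z m, z f) \<notin> rY" using stays(2)[OF k] by (simp add: m_def)
      have "r < m"
      proof (rule ccontr)
        assume "\<not> r < m"
        then have "heir m \<le> h" using heir_mono[of m r] range[OF m] \<open>heir r \<le> h\<close> by auto
        then have "(z (heir m), z h) \<in> rY"
          using heirs_ordered heir_range[OF m] range[OF hS] hG by blast
        then have *: "(z (heir m), z f) \<in> rY" using a(4) target_trans by blast
        have "m \<in> G" using heir_fixed[of m] * far range[OF m] by (cases "m \<in> G") auto
        then have "\<epsilon> m = -1" using signs[of m] * far target_trans by blast
        then show False using coeff[OF k(1)] \<open>\<not> r < m\<close> r(2)[OF kR] \<open>m \<in> G\<close>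
          by (auto simp: m_def coeff_def)
      qed
      then show "\<pi> k \<in> R - {r}" using m r(1) by (auto simp: m_def R_def)
    qed (use r R_def in auto)
  qed
  \<comment> \<open>For a ghost \<open>f\<close> the nonzero coefficient fixes the side: sign +1
    gives \<open>f \<le> i\<close> and \<open>z f\<close> at or before \<open>z h\<close>, excluded
    by \<open>left\<close>; sign -1 gives \<open>i < f\<close> and the opposite order, excluded by
    \<open>right\<close> with \<open>f\<close> as the live particle.\<close>
  have "f \<notin> G"
  proof
    assume g: "f \<in> G"
    show False
    proof (cases "\<epsilon> f = 1")
      case True
      then have "f \<le> i" using coeff[OF i] g by (auto simp: coeff_def f_def split: if_splits)
      then show False using left heir_less[OF g] signs[OF g] True by (auto simp: h_def)
    next
      case False
      then have "i < f" using coeff[OF i] g signs[OF g] by (auto simp: coeff_def f_def split: if_splits)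
      then show False using right[of f] signs[OF g] False fS by (auto simp: h_def)
    qed
  qed
  then have h: "h = f" using heir_fixed[of f] range[OF fS] by (auto simp: h_def)
  \<comment> \<open>With \<open>h = f\<close> the position hypotheses of \<open>left\<close> and
    \<open>right\<close> hold by reflexivity, which excludes \<open>f < i\<close>,
    \<open>i < f\<close> and any further particle with heir \<open>i\<close>.\<close>
  have refl: "(z f, z f) \<in> rY" using target_refl range[OF fS] by blast
  have "f = i" using left right[of f] h refl fS by (cases f i rule: linorder_cases) (auto simp: h_def)
  moreover have "heir s \<noteq> i" if "s \<in> S - {i}" for s
    using that right[of s] h refl \<open>f = i\<close> heir_props(2)[of s] range[of s] by force
  ultimately show ?thesis using \<open>f \<notin> G\<close> by (simp add: f_def)
qed

text \<open>A nonvanishing term assigns roles with nonzero coefficients along existing paths. This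
  forces the permutation to fix \<open>i\<close> and imposes the same condition as in
  \<open>family_sum_stop\<close>.\<close>

lemma set_det_stop:
  assumes S: "heir_closed S" and H: "history S u q" and low: "lone_lowest S u i"
  shows "set_det ((entry u)(i := \<lambda>m. coeff i m * of_bool (u i = z m))) S =
    (if u i = z i \<and> i \<notin> G \<and> (\<forall>s\<in>S - {i}. heir s \<noteq> i) then set_det (entry u) (S - {i}) else 0)"
    (is "set_det ?A S = (if ?P then _ else _)")
proof -
  note fin = heir_closedD(1)[OF S]
  have i: "i \<in> S" using low by (simp add: lone_lowest_def)
  have zero: "(\<Prod>k\<in>S. ?A k (\<pi> k)) = 0" if \<pi>: "\<pi> permutes S" and no: "\<not> (?P \<and> \<pi> i = i)" for \<pi>
  proof (rule ccontr)
    assume nonzero: "(\<Prod>k\<in>S. ?A k (\<pi> k)) \<noteq> 0"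
    have *: "?A k (\<pi> k) \<noteq> 0" if "k \<in> S" for k
    proof
      assume "?A k (\<pi> k) = 0"
      with that have "(\<Prod>k\<in>S. ?A k (\<pi> k)) = 0" by (intro prod_zero[OF fin] bexI)
      with nonzero show False ..
    qed
    have "u i = z (\<pi> i)" using *[OF i] by (cases "u i = z (\<pi> i)") auto
    moreover have "coeff k (\<pi> k) \<noteq> 0" if "k \<in> S" for k
      using *[OF that] by (cases "k = i") (auto simp: entry_def)
    moreover have "\<exists>p. is_path V E (u k) p (z (\<pi> k))" if "k \<in> S - {i}" for k
      using *[of k] that by (intro path_sum_nonzero) (auto simp: entry_def)
    ultimately show False using stopping_casting[OF S H low \<pi>] no by auto
  qed
  show ?thesis
  proof (cases ?P)
    case True
    have "set_det ?A S = ?A i i * set_det ?A (S - {i})"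
      using zero by (intro set_det_expand_diagonal[OF fin i]) blast
    also have "?A i i = 1" using True by (simp add: coeff_def)
    also have "set_det ?A (S - {i}) = set_det (entry u) (S - {i})" by (rule set_det_cong) auto
    finally show ?thesis unfolding if_P[OF True] by (simp only: mult_1_left)
  next
    case False
    then have "(\<Prod>k\<in>S. ?A k (\<pi> k)) = 0" if "\<pi> permutes S" for \<pi> using zero that by blast
    then have "set_det ?A S = 0"
      unfolding set_det_def by (intro sum.neutral ballI) (simp only: mem_Collect_eq mult_zero_right)
    then show ?thesis using False by (simp only: if_False)
  qed
qed

text \<open>(P2) gives a vertex of the middle path below the meeting point; as the pasts are disjoint, it
  can only be the meeting point itself.\<close>

lemma meeting_between:
  assumes S: "heir_closed S" and H: "history S u q" and lowest: "\<And>l. l \<in> S \<Longrightarrow> (u i, u l) \<in> leV"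
    and ijk: "i \<in> S" "j \<in> S" "k \<in> S" "i < j" "j < k" and meet: "u i = u k"
    and m: "m \<in> S" "is_path V E (u j) p (z m)" and m': "m' \<in> S" "is_path V E (u i) r (z m')"
  shows "u j = u i"
proof -
  have range: "l \<in> {1..n}" if "l \<in> S" for l using S that by (auto simp: heir_closed_def)
  have uV: "u i \<in> V" "u j \<in> V" using history_position[OF H] ijk by auto
  \<comment> \<open>The outer particles share a position, so a single continuation \<open>r\<close>
    serves both.\<close>
  have paths: "is_path V E (x i) (q i @ r) (z m')" "is_path V E (x j) (q j @ p) (z m)"
    "is_path V E (x k) (q k @ r) (z m')"
    using history_extend[OF H] ijk m(2) m'(2) meet by auto
  have "u i \<in> set r" using path_start_mem m'(2) by metis
  then obtain t where t: "(t, u i) \<in> leV" "t \<in> set (q j @ p)" "t \<in> set (q i @ r) \<union> set (q k @ r)"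
    using nested_crossing[OF _ _ _ _ _ _ _ _ paths, of "u i"] ijk m(1) m'(1) range by auto
  have "t = u i"
  proof (cases "t \<in> set r")
    case True
    then show ?thesis using path_le(1)[OF m'(2)] t(1) leV_antisym by blast
  next
    case False
    then obtain l where l: "l \<in> {i, k}" "t \<in> set (q l)" using t(3) by auto
    then have "t \<notin> set (q j)" "t \<notin> set p"
      using historyD(4)[OF H _ ijk(2), of l t] past_avoids_future[OF H _ ijk(2) l(2) m(2)] ijk by auto
    then show ?thesis using t(2) by auto
  qed
  moreover have "t \<notin> set (q j)" using historyD(3)[OF H ijk(2,1)] \<open>t = u i\<close> by blast
  ultimately have "(u j, u i) \<in> leV" using t(2) path_le(1)[OF m(2)] by auto
  then show ?thesis using lowest[OF ijk(2)] leV_antisym by blast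
qed

section \<open>Termination and the common recursion\<close>

definition relevant :: "'v set" where
  "relevant = (\<Union>k\<in>{1..n}. \<Union>m\<in>{1..n}. \<Union>p\<in>{p. is_path V E (x k) p (z m)}. set p)"

lemma finite_relevant: "finite relevant"
  unfolding relevant_def using finite_paths by auto

lemma relevantI:
  assumes "k \<in> {1..n}" "m \<in> {1..n}" "is_path V E (x k) p (z m)" "v \<in> set p"
  shows "v \<in> relevant"
  unfolding relevant_def using assms by blast

text \<open>There may be infinitely many vertices above a position, so only relevant ones are
  counted. A move loses at least one of them, and removing a particle drops a positive
  summand.\<close>

definition remaining :: "nat set \<Rightarrow> (nat \<Rightarrow> 'v) \<Rightarrow> nat" where
  "remaining S u = (\<Sum>k\<in>S. card {v \<in> relevant. (u k, v) \<in> leV})"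

lemma remaining_remove:
  assumes "finite S" "i \<in> S" "u i \<in> relevant" "u i \<in> V"
  shows "remaining (S - {i}) u < remaining S u"
proof -
  have "0 < card {v \<in> relevant. (u i, v) \<in> leV}"
    using finite_relevant assms leV_refl by (auto simp: card_gt_0_iff)
  then show ?thesis using assms by (simp add: remaining_def sum.remove[of S i])
qed

text \<open>The vertex left behind is relevant and no longer counted, whether or not the new
  position \<open>t\<close> is relevant.\<close>

lemma remaining_advance:
  assumes "finite S" "i \<in> S" "u i \<in> relevant" "(u i, t) \<in> E"
  shows "remaining S (u(i := t)) < remaining S u"
proof -
  have "u i \<in> V" using assms(4) edges_in by auto
  then have "{v \<in> relevant. (t, v) \<in> leV} \<subset> {v \<in> relevant. (u i, v) \<in> leV}"
    using edge_less[OF assms(4)] assms(3) leV_trans leV_antisym leV_refl by blast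
  then have "card {v \<in> relevant. (t, v) \<in> leV} < card {v \<in> relevant. (u i, v) \<in> leV}"
    using finite_relevant by (intro psubset_card_mono) auto
  moreover have "(\<Sum>k\<in>S - {i}. card {v \<in> relevant. ((u(i := t)) k, v) \<in> leV}) =
      (\<Sum>k\<in>S - {i}. card {v \<in> relevant. (u k, v) \<in> leV})"
    by (intro sum.cong) auto
  ultimately show ?thesis using assms(1,2) by (simp add: remaining_def sum.remove[of S i])
qed

theorem family_sum_eq_set_det:
  assumes "heir_closed S" "history S u q"
  shows "family_sum S u = set_det (entry u) S"
  using assms
proof (induction "remaining S u" arbitrary: S u q rule: less_induct)
  case less
  note S = less.prems(1) and H = less.prems(2)
  note fin = heir_closedD(1)[OF S]
  have range: "l \<in> {1..n}" if "l \<in> S" for l using S that by (auto simp: heir_closed_def)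
  have uV: "u k \<in> V" if "k \<in> S" for k using history_position[OF H that] .
  \<comment> \<open>In the second case both sides are 0. Once it is excluded, every live particle
    reaches a target of \<open>S\<close>, which makes all positions relevant and supplies the
    continuations to which (P2) is applied.\<close>
  consider "S = {}" | k where "k \<in> S" "\<forall>m\<in>S. \<forall>p. \<not> is_path V E (u k) p (z m)"
    | "S \<noteq> {}" "\<forall>k\<in>S. \<exists>m\<in>S. \<exists>p. is_path V E (u k) p (z m)" by blast
  then show ?case
  proof cases
    case 1
    then show ?thesis by (simp add: family_sum_empty)
  next
    case (2 k)
    have "family_sum S u = 0"
      using 2 heir_closedD(4)[OF S] by (intro family_sum_no_path[of k]) auto
    moreover have "entry u k m = 0" if "m \<in> S" for m
      using 2 that path_sum_nonzero[of "u k" "z m"]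
      by (cases "path_sum V E w (u k) (z m) = 0") (auto simp: entry_def)
    ultimately show ?thesis using set_det_zero_row[OF fin 2(1), of "entry u"] by simp
  next
    case 3
    have rel: "u k \<in> relevant" if k: "k \<in> S" for k
    proof -
      obtain m p where m: "m \<in> S" "is_path V E (u k) p (z m)" using 3 k by blast
      show ?thesis
        using relevantI[OF range[OF k] range[OF m(1)] history_extend[OF H k m(2)]] path_start_mem[OF m(2)]
        by simp
    qed
    obtain v where v: "v \<in> u ` S" "\<forall>t\<in>u ` S. (v, t) \<in> leV"
      using ex_least[of "u ` S"] fin 3(1) uV by auto
    define T where "T = {k \<in> S. u k = v}"
    \<comment> \<open>The leftmost particle at the lowest vertex. If it is not alone, its live
      neighbour \<open>j\<close> to the right turns out to be there too, so mergers always concern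
      neighbours.\<close>
    define i where "i = Min T"
    have T: "finite T" "T \<noteq> {}" using fin v by (auto simp: T_def)
    then have i: "i \<in> S" "u i = v" "\<And>k. k \<in> T \<Longrightarrow> i \<le> k"
      using Min_in[OF T] by (auto simp: i_def T_def)
    have lowest: "(u i, u l) \<in> leV" if "l \<in> S" for l using v(2) that i(2) by auto
    show ?thesis
    proof (cases "T = {i}")
      case False
      then obtain k where k: "k \<in> T" "k \<noteq> i" using T by blast
      then have "i < k" "k \<in> S" using i(3)[OF k(1)] by (auto simp: T_def)
      define J where "J = {l \<in> S. i < l}"
      define j where "j = Min J"
      have J: "finite J" "k \<in> J" using fin \<open>i < k\<close> \<open>k \<in> S\<close> by (auto simp: J_def)
      then have "j \<in> J" unfolding j_def by (intro Min_in) auto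
      then have j: "j \<in> S" "i < j" by (auto simp: J_def)
      have j_least: "j \<le> l" if "l \<in> S" "i < l" for l
        unfolding j_def using J that by (intro Min_le) (auto simp: J_def)
      have "u j = u i"
      proof (cases "j = k")
        case True
        then show ?thesis using k i by (simp add: T_def)
      next
        case False
        then have "j < k" using j_least[OF \<open>k \<in> S\<close> \<open>i < k\<close>] by simp
        obtain m p m' r where "m \<in> S" "is_path V E (u j) p (z m)" "m' \<in> S" "is_path V E (u i) r (z m')"
          using 3(2) j(1) i(1) by blast
        then show ?thesis
          using meeting_between[OF S H lowest i(1) j(1) \<open>k \<in> S\<close> j(2) \<open>j < k\<close>] k(1) i(2)
          by (auto simp: T_def)
      qed
      have adjacent: "l \<le> i" if "l \<in> S" "l < j" for l using j_least[OF that(1)] that(2) by force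
      have IH: "family_sum (S - {j}) u = set_det (entry u) (S - {j})" if "j \<in> G"
      proof (rule less.hyps)
        show "remaining (S - {j}) u < remaining S u"
          using remaining_remove[where u = u, OF fin j(1) rel[OF j(1)] uV[OF j(1)]] .
        \<comment> \<open>A ghost index is never a value of \<open>heir\<close>, so its removal
          keeps the set closed.\<close>
        show "heir_closed (S - {j})"
          using S that heir_props(3) range unfolding heir_closed_def by fastforce
        show "history (S - {j}) u q" by (rule history_subset[OF H]) auto
      qed
      show ?thesis
        using family_sum_merge[where u = u, OF S i(1) j _ adjacent] set_det_merge[where u = u, OF S i(1) j _ adjacent]
          \<open>u j = u i\<close> IH by auto
    next
      case True
      have low: "lone_lowest S u i" using i lowest True by (auto simp: lone_lowest_def T_def)
      \<comment> \<open>Keeping to relevant successors makes the sum finite, and no path to a target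
        in \<open>S\<close> leaves \<open>u i\<close> through another successor.\<close>
      define N where "N = {t \<in> relevant. (u i, t) \<in> E}"
      have N: "finite N" "\<And>t. t \<in> N \<Longrightarrow> (u i, t) \<in> E" using finite_relevant by (auto simp: N_def)
      have N_reach: "t \<in> N" if t: "(u i, t) \<in> E" and m: "m \<in> S" and p: "is_path V E t p (z m)" for t p m
      proof -
        have "is_path V E (x i) (q i @ u i # p) (z m)"
          by (rule history_extend[OF H i(1) is_path_ConsI[OF t uV[OF i(1)] p]])
        then have "t \<in> relevant"
          using relevantI[OF range[OF i(1)] range[OF m]] path_start_mem[OF p] by simp
        then show ?thesis using t by (simp add: N_def)
      qed
      have advance: "family_sum S (u(i := t)) = set_det (entry (u(i := t))) S" if "t \<in> N" for t
        using less.hyps[OF remaining_advance[where u = u, OF fin i(1) rel[OF i(1)] N(2)[OF that]] S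
            history_advance[OF H low N(2)[OF that]]] .
      \<comment> \<open>The condition that no other live particle has heir \<open>i\<close> is what
        keeps \<open>S - {i}\<close> closed.\<close>
      have stop: "family_sum (S - {i}) u = set_det (entry u) (S - {i})"
        if "\<forall>s\<in>S - {i}. heir s \<noteq> i"
      proof (rule less.hyps)
        show "remaining (S - {i}) u < remaining S u"
          using remaining_remove[where u = u, OF fin i(1) rel[OF i(1)] uV[OF i(1)]] .
        show "heir_closed (S - {i})" using S that by (auto simp: heir_closed_def)
        show "history (S - {i}) u q" by (rule history_subset[OF H]) auto
      qed
      have "family_sum S u = (\<Sum>p | p \<in> families S u \<and> p i = [u i]. family_weight S p) +
          (\<Sum>t\<in>N. w (u i, t) * family_sum S (u(i := t)))"
        using N_reach heir_closedD(4)[OF S i(1)] by (intro family_sum_advance[OF S low uV[OF i(1)] N]) auto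
      also have "(\<Sum>p | p \<in> families S u \<and> p i = [u i]. family_weight S p) =
          set_det ((entry u)(i := \<lambda>m. coeff i m * of_bool (u i = z m))) S"
        unfolding family_sum_stop[OF S low uV[OF i(1)]] set_det_stop[OF S H low] using stop by auto
      also have "(\<Sum>t\<in>N. w (u i, t) * family_sum S (u(i := t))) =
          (\<Sum>t\<in>N. w (u i, t) * set_det (entry (u(i := t))) S)"
        using advance by (intro sum.cong) auto
      also have "set_det ((entry u)(i := \<lambda>m. coeff i m * of_bool (u i = z m))) S + \<dots> =
          set_det (entry u) S"
        using N_reach by (intro set_det_advance[where u = u, OF S i(1) uV[OF i(1)] N, symmetric]) auto
      finally show ?thesis .
    qed
  qed
qed

corollary family_sum_initial: "family_sum {1..n} x = set_det (entry x) {1..n}"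
proof (rule family_sum_eq_set_det)
  show "heir_closed {1..n}" using heir_props(1,2) by (force simp: heir_closed_def)
  have "x k \<in> V" if "k \<in> {1..n}" for k
    using that initial planar by (auto simp: initial_state_def planar_pair_def)
  then show "history {1..n} x (\<lambda>_. [])" by (auto simp: history_def is_path_def)
qed

end

section \<open>Genealogy forests\<close>

lemma in_tree_single_valued:
  assumes "is_in_tree V E T r"
  shows "single_valued (snd T)"
proof (rule single_valuedI)
  fix v a b assume ab: "(v, a) \<in> snd T" "(v, b) \<in> snd T"
  then have "v \<in> fst T - {r}" using assms by (auto simp: is_in_tree_def)
  then have "\<exists>!u. (v, u) \<in> snd T" using assms by (auto simp: is_in_tree_def)
  then show "a = b" using ab by blast
qed

lemma trajectory_eqI:
  assumes "is_in_tree V E T r" "is_path (fst T) (snd T) v p r"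
  shows "trajectory T v r = p"
  unfolding trajectory_def
proof (rule the_equality)
  show "q = p" if "is_path (fst T) (snd T) v q r" for q
    using single_valued_path_unique[OF in_tree_single_valued[OF assms(1)] _ that assms(2)] assms(1)
    by (auto simp: is_in_tree_def)
qed (rule assms)

lemma trajectory_path:
  assumes "is_in_tree V E T r" "v \<in> fst T"
  shows "is_path (fst T) (snd T) v (trajectory T v r) r"
proof -
  obtain p where "is_path (fst T) (snd T) v p r"
    using rtrancl_imp_path[of v r "snd T" "fst T"] assms by (auto simp: is_in_tree_def)
  then show ?thesis using trajectory_eqI[OF assms(1)] by blast
qed

text \<open>Here roles are labels, as in the statement; \<open>role\<close> translates minima into
  labels and so provides the data of \<open>casting\<close>.\<close>

locale staging = spacetime V E leV for V :: "'v set" and E leV +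
  fixes w :: "'v \<times> 'v \<Rightarrow> 'a::comm_ring_1"
    and X :: "'v set" and rX :: "'v rel" and Y :: "'v set" and rY :: "'v rel"
    and n :: nat and G :: "nat set" and x :: "nat \<Rightarrow> 'v" and y :: "label \<Rightarrow> 'v"
    and \<epsilon> :: "nat \<Rightarrow> int"
  assumes planar: "planar_pair V E leV X rX Y rY"
    and initial: "initial_state X rX n x"
    and final: "final_state Y rY n G y"
    and sign: "ghost_sign rY n G y \<epsilon>"
begin

lemma ghost_junctions: "G \<subseteq> junctions n"
  using final by (simp add: final_state_def)

abbreviation role :: "nat \<Rightarrow> label" where "role \<equiv> role_at n G"

lemma role:
  assumes "m \<in> {1..n}"
  shows "role m \<in> roles n G" "label_min (role m) = m"
  using bij_betw_label_min[OF ghost_junctions] assms unfolding role_at_def bij_betw_def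
  by (auto intro: the_inv_into_into f_the_inv_into_f)

lemma role_label_min: "f \<in> roles n G \<Longrightarrow> role (label_min f) = f"
  using bij_betw_label_min[OF ghost_junctions] unfolding role_at_def bij_betw_def
  by (auto intro: the_inv_into_f_f)

lemma role_ghost: "g \<in> G \<Longrightarrow> role g = Junction g"
  using role_label_min[of "Junction g"] by (auto simp: roles_def)

lemma role_heir:
  assumes "m \<in> {1..n}" "m \<notin> G"
  shows "role m \<in> heirs n G" "\<exists>b. role m = Ival m b"
proof -
  show heir: "role m \<in> heirs n G" using role[OF assms(1)] assms(2) by (auto simp: roles_def)
  show "\<exists>b. role m = Ival m b" using heirs_Ival[OF heir] role(2)[OF assms(1)] by auto
qed

lemma label_min_heir:
  assumes "H \<in> heirs n G"
  shows "label_min H \<in> {1..n}" "label_min H \<notin> G" "role (label_min H) = H"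
proof -
  obtain a b where H: "H = Ival a b" using heirs_Ival[OF assms] by blast
  then show "label_min H \<in> {1..n}" "label_min H \<notin> G"
    using assms ghost_junctions by (auto simp: heirs_iff[OF ghost_junctions] junctions_def)
  show "role (label_min H) = H" using assms by (auto simp: roles_def role_label_min)
qed

text \<open>For \<open>k < m\<close> the non-ghost \<open>m\<close> is a junction that cuts, so the
  heir starting at \<open>k\<close> ends at or before it and precedes the heir of \<open>m\<close>
  in label order.\<close>

lemma final_le:
  assumes "k \<in> {1..n} - G" "m \<in> {1..n} - G" "k \<le> m"
  shows "(y (role k), y (role m)) \<in> rY"
proof (cases "k = m")
  case True
  then show ?thesis
    using role[of m] assms final planar
    by (auto simp: final_state_def planar_pair_def order_on_defs refl_on_def)
next
  case False
  then have "k < m" "m \<in> junctions n - G" using assms by (auto simp: junctions_def)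
  obtain b b' where b: "role k = Ival k b" "role m = Ival m b'" using role_heir assms by blast
  have heirs: "role k \<in> heirs n G" "role m \<in> heirs n G" using role_heir assms by auto
  have "b \<le> m"
    using heirs(1) \<open>k < m\<close> \<open>m \<in> junctions n - G\<close> by (force simp: b heirs_iff[OF ghost_junctions])
  then have "role k \<triangleleft> role m" by (simp add: b)
  then show ?thesis using heirs final by (simp add: final_state_def)
qed

lemma heir_min_eqI:
  assumes "1 \<le> a" "a \<le> m" "a \<notin> G" "\<And>k. a < k \<Longrightarrow> k \<le> m \<Longrightarrow> k \<in> G"
  shows "heir_min G m = a"
  unfolding heir_min_def using assms by (intro Max_eqI) (auto intro: leI)

text \<open>In an heir \<open>[a,b)\<close> all interior junctions are ghosts, while
  \<open>a\<close> and, if \<open>b \<le> n\<close>, also \<open>b\<close> are not. So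
  \<open>a\<close> is the largest non-ghost index up to \<open>j\<close> exactly for
  \<open>a \<le> j < b\<close>.\<close>

lemma actors_in_iff:
  assumes "H \<in> heirs n G" "j \<in> {1..n}"
  shows "j \<in> actors_in n H \<longleftrightarrow> heir_min G j = label_min H"
proof -
  obtain a b where H: "H = Ival a b" using heirs_Ival[OF assms(1)] by blast
  have ab: "1 \<le> a" "a < b" "b \<le> n + 1" "\<forall>g\<in>junctions n - G. \<not> (a < g \<and> g < b)"
    "b = n + 1 \<or> b \<in> junctions n - G" "a \<notin> G"
    using assms(1) label_min_heir[OF assms(1)] by (auto simp: H heirs_iff[OF ghost_junctions])
  have "j \<in> actors_in n H \<longleftrightarrow> a \<le> j \<and> j < b"
    using assms(2) by (auto simp: actors_in_def actor_def H)
  also have "\<dots> \<longleftrightarrow> heir_min G j = a"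
  proof
    assume j: "a \<le> j \<and> j < b"
    show "heir_min G j = a"
      by (rule heir_min_eqI) (use ab j assms(2) in \<open>auto simp: junctions_def\<close>)
  next
    assume "heir_min G j = a"
    then have max: "Max {k \<in> {1..j}. k \<notin> G} = a" by (simp add: heir_min_def)
    have "1 \<in> {k \<in> {1..j}. k \<notin> G}" using assms(2) ghost_junctions by (auto simp: junctions_def)
    then have "a \<in> {k \<in> {1..j}. k \<notin> G}" using max Max_in[of "{k \<in> {1..j}. k \<notin> G}"] by auto
    moreover have "j < b"
    proof (rule ccontr)
      assume "\<not> j < b"
      then have "b \<noteq> n + 1" using assms(2) by auto
      then have "b \<in> {k \<in> {1..j}. k \<notin> G}" using ab(1,2,5) \<open>\<not> j < b\<close> by auto
      then have "b \<le> Max {k \<in> {1..j}. k \<notin> G}" by (intro Max_ge) auto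
      then show False using ab(2) unfolding max by simp
    qed
    ultimately show "a \<le> j \<and> j < b" by auto
  qed
  finally show ?thesis by (simp add: H)
qed

lemma heir_of_eq:
  assumes "g \<in> G"
  shows "heir_of n G g = role (heir_min G g)"
proof -
  note h = heir_of[OF ghost_junctions assms]
  have g: "g \<in> {1..n}" using assms ghost_junctions by (auto simp: junctions_def)
  obtain a b where ab: "heir_of n G g = Ival a b" using heirs_Ival[OF h(1)] by blast
  have "g \<in> actors_in n (heir_of n G g)" using h(2) g by (simp add: ab actors_in_def actor_def)
  then show ?thesis using actors_in_iff[OF h(1) g] label_min_heir(3)[OF h(1)] by simp
qed

sublocale casting V E leV w X rX Y rY n G x "\<lambda>m. y (role m)" \<epsilon>
proof
  show "planar_pair V E leV X rX Y rY" "initial_state X rX n x" by (fact planar initial)+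
  show "G \<subseteq> {2..n}" using ghost_junctions by (simp add: junctions_def)
  show "y (role m) \<in> Y" if "m \<in> {1..n}" for m
    using role(1)[OF that] final by (auto simp: final_state_def)
  show "(y (role k), y (role m)) \<in> rY" if "k \<in> {1..n} - G" "m \<in> {1..n} - G" "k \<le> m" for k m
    using final_le[OF that] .
  show "\<epsilon> g = 1 \<and> (y (role g), y (role (heir_min G g))) \<in> rY \<or>
      \<epsilon> g = - 1 \<and> (y (role (heir_min G g)), y (role g)) \<in> rY" if "g \<in> G" for g
    using sign that by (auto simp: ghost_sign_def heir_of_eq role_ghost)
qed

lemma det_performance_matrix:
  "det (performance_matrix V E w n G x y \<epsilon>) = set_det (entry x) {1..n}"
proof -
  have "matrix_entry V E w x y \<epsilon> j (role m) = entry x j m" if m: "m \<in> {1..n}" for j m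
  proof (cases "m \<in> G")
    case True
    then show ?thesis by (auto simp: matrix_entry_def entry_def coeff_def role_ghost actor_def)
  next
    case False
    obtain b where "role m = Ival m b" using role_heir(2)[OF m False] by blast
    then show ?thesis using False by (simp add: matrix_entry_def entry_def coeff_def)
  qed
  then have "set_det (entry x) {1..n} = set_det (\<lambda>j m. matrix_entry V E w x y \<epsilon> j (role m)) {1..n}"
    by (intro set_det_cong) auto
  then show ?thesis
    using det_mat_eq_set_det[of n "\<lambda>j m. matrix_entry V E w x y \<epsilon> j (role m)"]
    by (simp only: performance_matrix_def)
qed

section \<open>Forests as families of trajectories\<close>

abbreviation heir_role :: "nat \<Rightarrow> label" where "heir_role j \<equiv> role (heir j)"

lemma heir_range: "j \<in> {1..n} \<Longrightarrow> heir j \<in> {1..n}" "j \<in> {1..n} \<Longrightarrow> heir j \<notin> G"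
  using heir_props[of j] by auto

lemma heir_role: "j \<in> {1..n} \<Longrightarrow> heir_role j \<in> heirs n G"
  using role_heir(1) heir_range by blast

lemma mem_actors_in:
  assumes "H \<in> heirs n G"
  shows "j \<in> actors_in n H \<longleftrightarrow> j \<in> {1..n} \<and> heir_role j = H"
proof (cases "j \<in> {1..n}")
  case True
  then show ?thesis
    using actors_in_iff[OF assms True] label_min_heir(3)[OF assms] role(2) heir_range by auto
qed (auto simp: actors_in_def)

lemma heir_role_inj: "j \<in> {1..n} \<Longrightarrow> l \<in> {1..n} \<Longrightarrow> heir_role j = heir_role l \<Longrightarrow> heir j = heir l"
  using role(2) heir_range by metis

lemma finite_heirs: "finite (heirs n G)"
proof -
  have "finite (roles n G)" using bij_betw_finite[OF bij_betw_label_min[OF ghost_junctions]] by simp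
  then show ?thesis by (rule rev_finite_subset) (auto simp: roles_def)
qed

lemma Union_heirs: "(\<Union>H\<in>heirs n G. \<Union>j\<in>actors_in n H. A j) = (\<Union>j\<in>{1..n}. A j)"
  using mem_actors_in heir_role by fast

definition forest_family :: "(label \<Rightarrow> 'v subgraph) \<Rightarrow> nat \<Rightarrow> 'v list" where
  "forest_family T = (\<lambda>j\<in>{1..n}. trajectory (T (heir_role j)) (x j) (y (heir_role j)))"

text \<open>The inverse of \<open>forest_family\<close>: a tree of the forest is the union of its
  trajectories, so these unions rebuild it.\<close>

definition family_forest :: "(nat \<Rightarrow> 'v list) \<Rightarrow> label \<Rightarrow> 'v subgraph" where
  "family_forest p = (\<lambda>H\<in>heirs n G.
     (\<Union>j\<in>actors_in n H. set (p j), \<Union>j\<in>actors_in n H. set (path_edges (p j))))"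

abbreviation forests :: "(label \<Rightarrow> 'v subgraph) set" where
  "forests \<equiv> {T. genealogy_forest V E n G x y T}"

lemma forestD:
  assumes "T \<in> forests"
  shows "T \<in> extensional (heirs n G)"
    and "H \<in> heirs n G \<Longrightarrow> is_in_tree V E (T H) (y H)"
    and "H \<in> heirs n G \<Longrightarrow> j \<in> actors_in n H \<Longrightarrow> x j \<in> fst (T H)"
    and "H \<in> heirs n G \<Longrightarrow> fst (T H) = (\<Union>j\<in>actors_in n H. set (forest_family T j))"
    and "H \<in> heirs n G \<Longrightarrow> snd (T H) = (\<Union>j\<in>actors_in n H. set (path_edges (forest_family T j)))"
    and "H \<in> heirs n G \<Longrightarrow> H' \<in> heirs n G \<Longrightarrow> v \<in> fst (T H) \<Longrightarrow> v \<in> fst (T H') \<Longrightarrow> H = H'"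
proof -
  have F: "genealogy_forest V E n G x y T" using assms by simp
  then show "T \<in> extensional (heirs n G)"
    and "H \<in> heirs n G \<Longrightarrow> is_in_tree V E (T H) (y H)"
    and "H \<in> heirs n G \<Longrightarrow> j \<in> actors_in n H \<Longrightarrow> x j \<in> fst (T H)"
    and "H \<in> heirs n G \<Longrightarrow> H' \<in> heirs n G \<Longrightarrow> v \<in> fst (T H) \<Longrightarrow> v \<in> fst (T H') \<Longrightarrow> H = H'"
    unfolding genealogy_forest_def by blast+
  assume H: "H \<in> heirs n G"
  have traj: "forest_family T j = trajectory (T H) (x j) (y H)" if "j \<in> actors_in n H" for j
    using that mem_actors_in[OF H] by (auto simp: forest_family_def)
  have "fst (T H) = (\<Union>j\<in>actors_in n H. set (trajectory (T H) (x j) (y H)))"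
    "snd (T H) = (\<Union>j\<in>actors_in n H. set (path_edges (trajectory (T H) (x j) (y H))))"
    using F H unfolding genealogy_forest_def by blast+
  then show "fst (T H) = (\<Union>j\<in>actors_in n H. set (forest_family T j))"
    "snd (T H) = (\<Union>j\<in>actors_in n H. set (path_edges (forest_family T j)))"
    using traj by simp_all
qed

lemma forest_family_path:
  assumes "T \<in> forests" "j \<in> {1..n}"
  shows "is_path (fst (T (heir_role j))) (snd (T (heir_role j))) (x j) (forest_family T j) (y (heir_role j))"
proof -
  note H = heir_role[OF assms(2)]
  have "j \<in> actors_in n (heir_role j)" using mem_actors_in[OF H] assms(2) by simp
  then show ?thesis
    using trajectory_path[OF forestD(2)[OF assms(1) H] forestD(3)[OF assms(1) H]] assms(2)
    by (simp add: forest_family_def)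
qed

text \<open>Edges leaving one vertex lie in the same tree, as the trees are disjoint, and inside a
  tree the outgoing edge is unique; so the edges of all trees together are single-valued.\<close>

lemma forest_family_in: "T \<in> forests \<Longrightarrow> forest_family T \<in> families {1..n} x"
proof (rule familiesI)
  assume T: "T \<in> forests"
  note path = forest_family_path[OF T]
  show "is_path V E (x k) (forest_family T k) (y (heir_role k))" if k: "k \<in> {1..n}" for k
    using is_path_mono[OF path[OF k]] forestD(2)[OF T heir_role[OF k]] by (simp add: is_in_tree_def)
  show "heir k = heir l"
    if "k \<in> {1..n}" "l \<in> {1..n}" "v \<in> set (forest_family T k)" "v \<in> set (forest_family T l)" for k l v
  proof -
    have "v \<in> fst (T (heir_role k))" "v \<in> fst (T (heir_role l))"
      using path that by (auto simp: is_path_def)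
    then show ?thesis using forestD(6)[OF T heir_role heir_role] heir_role_inj that by blast
  qed
  show "single_valued (tree_edges {1..n} (forest_family T))"
  proof (rule single_valuedI)
    fix v a b
    assume "(v, a) \<in> tree_edges {1..n} (forest_family T)" "(v, b) \<in> tree_edges {1..n} (forest_family T)"
    then obtain k l where k: "k \<in> {1..n}" "(v, a) \<in> set (path_edges (forest_family T k))"
      and l: "l \<in> {1..n}" "(v, b) \<in> set (path_edges (forest_family T l))"
      by (auto simp: tree_edges_def)
    have ab: "(v, a) \<in> snd (T (heir_role k))" "(v, b) \<in> snd (T (heir_role l))"
      using path[OF k(1)] path[OF l(1)] k(2) l(2) by (auto simp: is_path_iff_edges)
    note trees = forestD(2)[OF T heir_role[OF k(1)]] forestD(2)[OF T heir_role[OF l(1)]]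
    have "v \<in> fst (T (heir_role k))" "v \<in> fst (T (heir_role l))"
      using ab trees by (auto simp: is_in_tree_def)
    then have "heir_role k = heir_role l" using forestD(6)[OF T heir_role heir_role] k(1) l(1) by blast
    then show "a = b" using ab in_tree_single_valued[OF trees(1)] by (auto dest: single_valuedD)
  qed
qed (simp add: forest_family_def)

lemma family_forest_inverse:
  assumes T: "T \<in> forests"
  shows "family_forest (forest_family T) = T"
proof (rule extensionalityI)
  show "family_forest (forest_family T) \<in> extensional (heirs n G)" by (simp add: family_forest_def)
  show "family_forest (forest_family T) H = T H" if "H \<in> heirs n G" for H
    using that forestD(4,5)[OF T that] by (simp add: family_forest_def prod_eq_iff)
qed (rule forestD(1)[OF T])

text \<open>A vertex other than the root has the next edge of a trajectory as an exit, which is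
  unique by single-valuedness; the root has none by \<open>root_no_exit\<close>.\<close>

lemma family_forest_tree:
  assumes p: "p \<in> families {1..n} x" and H: "H \<in> heirs n G"
  shows "is_in_tree V E (family_forest p H) (y H)"
    and "j \<in> actors_in n H \<Longrightarrow> is_path (fst (family_forest p H)) (snd (family_forest p H)) (x j) (p j) (y H)"
proof -
  have T: "family_forest p H =
      (\<Union>j\<in>actors_in n H. set (p j), \<Union>j\<in>actors_in n H. set (path_edges (p j)))"
    using H by (simp add: family_forest_def)
  have path: "is_path V E (x j) (p j) (y H)" "j \<in> {1..n}" if "j \<in> actors_in n H" for j
    using familiesD(2)[OF p, of j] that mem_actors_in[OF H] by auto
  then show in_tree: "is_path (fst (family_forest p H)) (snd (family_forest p H)) (x j) (p j) (y H)"
    if "j \<in> actors_in n H" for j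
    using that by (fastforce simp: T is_path_iff_edges)
  have sub: "snd (family_forest p H) \<subseteq> tree_edges {1..n} p"
    unfolding T tree_edges_def snd_conv using path(2) by (intro UN_mono subset_refl) blast
  \<comment> \<open>The leftmost actor of \<open>H\<close> shows that the tree is not empty and
    hence contains its root.\<close>
  define a where "a = label_min H"
  have a: "a \<in> actors_in n H"
    using mem_actors_in[OF H] label_min_heir[OF H] heir_fixed[of a] by (simp add: a_def)
  have root: "y H = y (heir_role a)" using a mem_actors_in[OF H] by simp
  show "is_in_tree V E (family_forest p H) (y H)"
    unfolding is_in_tree_def
  proof (intro conjI ballI allI)
    show "fst (family_forest p H) \<subseteq> V" "snd (family_forest p H) \<subseteq> E"
      using path(1) by (fastforce simp: T is_path_iff_edges)+
    show "snd (family_forest p H) \<subseteq> fst (family_forest p H) \<times> fst (family_forest p H)"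
      using set_path_edges by (fastforce simp: T)
    show "y H \<in> fst (family_forest p H)" using path_end_mem[OF path(1)[OF a]] a by (auto simp: T)
    show no_exit: "(y H, u) \<notin> snd (family_forest p H)" for u
      using root_no_exit[OF p path(2)[OF a], of u] root sub by auto
    fix v
    show "(v, y H) \<in> (snd (family_forest p H))\<^sup>*" if v: "v \<in> fst (family_forest p H)"
    proof -
      obtain j where "j \<in> actors_in n H" "v \<in> set (p j)" using v by (auto simp: T)
      then show ?thesis using path_reaches(2)[OF in_tree] by blast
    qed
    show "\<exists>!u. (v, u) \<in> snd (family_forest p H)" if v: "v \<in> fst (family_forest p H) - {y H}"
    proof -
      obtain j where j: "j \<in> actors_in n H" "v \<in> set (p j)" using v by (auto simp: T)
      have "v \<noteq> last (p j)" using path(1)[OF j(1)] v by (auto simp: is_path_def)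
      then obtain u where "(v, u) \<in> snd (family_forest p H)" using path_exit[OF j(2)] j(1) by (auto simp: T)
      then show ?thesis using familiesD(3)[OF p] sub by (blast dest: single_valuedD)
    qed
  qed
qed

lemma forest_family_inverse:
  assumes p: "p \<in> families {1..n} x"
  shows "forest_family (family_forest p) = p"
proof (rule extensionalityI[of _ "{1..n}"])
  show "forest_family (family_forest p) j = p j" if "j \<in> {1..n}" for j
    using trajectory_eqI[OF family_forest_tree(1)[OF p] family_forest_tree(2)[OF p]]
      heir_role[OF that] mem_actors_in that by (simp add: forest_family_def)
qed (use familiesD(1)[OF p] in \<open>simp_all add: forest_family_def\<close>)

lemma family_forest_in:
  assumes p: "p \<in> families {1..n} x"
  shows "family_forest p \<in> forests"
proof -
  have traj: "trajectory (family_forest p H) (x j) (y H) = p j" if "H \<in> heirs n G" "j \<in> actors_in n H" for H j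
    using trajectory_eqI[OF family_forest_tree(1)[OF p that(1)] family_forest_tree(2)[OF p that]] .
  have disjoint: "fst (family_forest p H) \<inter> fst (family_forest p H') = {}"
    if H: "H \<in> heirs n G" "H' \<in> heirs n G" "H \<noteq> H'" for H H'
  proof (rule ccontr)
    assume "\<not> ?thesis"
    then obtain v j l where jl: "j \<in> actors_in n H" "l \<in> actors_in n H'" "v \<in> set (p j)" "v \<in> set (p l)"
      using H by (auto simp: family_forest_def)
    then have "heir j = heir l"
      using familiesD(4)[OF p, of j l v] mem_actors_in[OF H(1)] mem_actors_in[OF H(2)] by simp
    then show False using jl(1,2) mem_actors_in[OF H(1)] mem_actors_in[OF H(2)] H(3) by simp
  qed
  have "x ` actors_in n H \<subseteq> fst (family_forest p H)" if "H \<in> heirs n G" for H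
    using path_start_mem[OF family_forest_tree(2)[OF p that]] that by (auto simp: family_forest_def)
  then show ?thesis
    using family_forest_tree(1)[OF p] traj disjoint
    by (auto simp: genealogy_forest_def family_forest_def)
qed

lemma vertex_label_iff:
  "j \<in> vertex_label n G x y T v \<longleftrightarrow> j \<in> {1..n} \<and> v \<in> set (forest_family T j)"
proof -
  have "j \<in> vertex_label n G x y T v \<longleftrightarrow>
      (\<exists>H\<in>heirs n G. j \<in> actors_in n H \<and> v \<in> set (trajectory (T H) (x j) (y H)))"
    by (auto simp: vertex_label_def)
  then show ?thesis using mem_actors_in heir_role by (auto simp: forest_family_def)
qed

text \<open>Trajectories lie in the forest, so the vertices labelled by both \<open>g - 1\<close>
  and \<open>g\<close> are the common vertices of these two; with all actors live,
  \<open>g - 1\<close> is the left neighbour of \<open>g\<close>.\<close>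

lemma coalescence_vertex_eq:
  assumes T: "T \<in> forests" and g: "g \<in> G"
  shows "coalescence_vertex leV n G x y T g =
    least (set (forest_family T (pred_in {1..n} g)) \<inter> set (forest_family T g))"
proof -
  have range: "2 \<le> g" "g \<le> n" using g ghosts by (auto simp: junctions_def)
  have "pred_in {1..n} g = g - 1" using range by (intro pred_in_eqI) auto
  moreover have "v \<in> (\<Union>H\<in>heirs n G. fst (T H))" if "v \<in> set (forest_family T g)" for v
    using forest_family_path[OF T, of g] heir_role[of g] that range by (auto simp: is_path_def)
  then have "{v \<in> (\<Union>H\<in>heirs n G. fst (T H)). {g - 1, g} \<subseteq> vertex_label n G x y T v} =
      set (forest_family T (g - 1)) \<inter> set (forest_family T g)"
    using range by (auto simp: vertex_label_iff)
  ultimately show ?thesis by (simp add: coalescence_vertex_def least_def)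
qed

text \<open>Disjoint trees have disjoint edge sets, so the double product is one product over
  \<open>tree_edges\<close>.\<close>

lemma forest_weight:
  assumes T: "T \<in> forests"
  shows "(\<Prod>H\<in>heirs n G. \<Prod>e\<in>snd (T H). w e) *
      (\<Prod>g\<in>G. path_sum V E w (coalescence_vertex leV n G x y T g) (y (Junction g))) =
    family_weight {1..n} (forest_family T)"
proof -
  have source: "v \<in> fst (T H)" if "H \<in> heirs n G" "(v, t) \<in> snd (T H)" for H v t
    using forestD(2)[OF T that(1)] that(2) by (auto simp: is_in_tree_def)
  have "finite (snd (T H))" if "H \<in> heirs n G" for H
    unfolding forestD(5)[OF T that] by (auto simp: actors_in_def)
  moreover have "snd (T H) \<inter> snd (T H') = {}" if "H \<in> heirs n G" "H' \<in> heirs n G" "H \<noteq> H'" for H H'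
    using forestD(6)[OF T that(1,2)] source[OF that(1)] source[OF that(2)] that(3) by fast
  ultimately have "(\<Prod>H\<in>heirs n G. \<Prod>e\<in>snd (T H). w e) = (\<Prod>e\<in>(\<Union>H\<in>heirs n G. snd (T H)). w e)"
    using finite_heirs by (intro prod.UNION_disjoint[symmetric]) auto
  also have "(\<Union>H\<in>heirs n G. snd (T H)) = tree_edges {1..n} (forest_family T)"
    unfolding tree_edges_def Union_heirs[symmetric] using forestD(5)[OF T] by simp
  finally have trees: "(\<Prod>H\<in>heirs n G. \<Prod>e\<in>snd (T H). w e) = (\<Prod>e\<in>tree_edges {1..n} (forest_family T). w e)" .
  have "{1..n} \<inter> G = G" using ghosts by (auto simp: junctions_def)
  then show ?thesis
    unfolding family_weight_def trees using coalescence_vertex_eq[OF T]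
    by (auto simp: ghost_factor_def role_ghost intro!: prod.cong arg_cong[where f = "(*) _"])
qed

text \<open>For a fixed forest the ghost paths are chosen independently, so summing over them gives
  a product of path sums from the coalescence vertices.\<close>

lemma partition_function_eq: "partition_function V E leV w n G x y = family_sum {1..n} x"
proof -
  let ?paths = "\<lambda>T g. {p. is_path V E (coalescence_vertex leV n G x y T g) p (y (Junction g))}"
  have bij: "bij_betw forest_family forests (families {1..n} x)"
    by (rule bij_betw_byWitness[where f' = family_forest])
      (use forest_family_in family_forest_in family_forest_inverse forest_family_inverse in auto)
  have fin: "finite forests" "finite G"
    using bij_betw_finite[OF bij] finite_families[of "{1..n}"] ghosts finite_subset[of G "{2..n}"]
    by (auto simp: junctions_def)
  have "performances V E leV n G x y = Sigma forests (\<lambda>T. PiE G (?paths T))"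
    by (auto simp: performances_def PiE_iff dest: extensional_arb)
  then have "partition_function V E leV w n G x y =
      (\<Sum>T\<in>forests. \<Sum>\<Gamma>\<in>PiE G (?paths T). performance_weight w n G (T, \<Gamma>))"
    unfolding partition_function_def
    by (simp add: sum.Sigma fin finite_PiE finite_paths split_def)
  also have "\<dots> = (\<Sum>T\<in>forests. family_weight {1..n} (forest_family T))"
  proof (rule sum.cong[OF refl])
    fix T assume T: "T \<in> forests"
    have "(\<Sum>\<Gamma>\<in>PiE G (?paths T). performance_weight w n G (T, \<Gamma>)) =
        (\<Prod>H\<in>heirs n G. \<Prod>e\<in>snd (T H). w e) * (\<Prod>g\<in>G. \<Sum>p\<in>?paths T g. path_weight w p)"
      by (simp add: performance_weight_def sum_distrib_left[symmetric] prod_sum_PiE fin finite_paths)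
    then show "(\<Sum>\<Gamma>\<in>PiE G (?paths T). performance_weight w n G (T, \<Gamma>)) =
        family_weight {1..n} (forest_family T)"
      using forest_weight[OF T] by (simp add: path_sum_def)
  qed
  also have "\<dots> = family_sum {1..n} x"
    unfolding family_sum_def by (rule sum.reindex_bij_betw[OF bij])
  finally show ?thesis .
qed

end

theorem theorem3p2:
  fixes V :: "'v set" and E leV :: "'v rel"
    and w :: "'v \<times> 'v \<Rightarrow> 'a::comm_ring_1"
    and X Y :: "'v set" and rX rY :: "'v rel"
    and n :: nat and G :: "nat set"
    and x :: "nat \<Rightarrow> 'v" and y :: "label \<Rightarrow> 'v" and \<epsilon> :: "nat \<Rightarrow> int"
  assumes "spacetime_graph V E leV"
    and "planar_pair V E leV X rX Y rY"
    and "initial_state X rX n x"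
    and "final_state Y rY n G y"
    and "ghost_sign rY n G y \<epsilon>"
  shows "partition_function V E leV w n G x y = det (performance_matrix V E w n G x y \<epsilon>)"
proof -
  interpret staging V E leV w X rX Y rY n G x y \<epsilon> by unfold_locales (fact assms)+
  show ?thesis by (simp only: partition_function_eq det_performance_matrix family_sum_initial)
qed

end
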